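(* Let $\mu\in\mathcal M_+(\mathbb T)$ and $m\in\mathbb N$. If $\alpha>\frac12$, then $\|\sigma_n^\alpha[f]-f\|_{\mu,m}\to0$ as $n\to\infty$ for every $f\in\mathcal H_{\mu,m}$.
   Context: $\mathbb N$ is the set of positive integers, $\mathbb D$ the open unit disc and $\mathbb T$ the unit circle in $\mathbb C$; $\mathcal O(\mathbb D)$ is the space of holomorphic functions on $\mathbb D$; $\mathcal M_+(\mathbb T)$ is the set of finite non-negative Borel measures on $\mathbb T$. For $\mu\in\mathcal M_+(\mathbb T)$, $m\in\mathbb N$ and $f\in\mathcal O(\mathbb D)$, the weighted Dirichlet-type integral of $f$ of order $m$ is $$D_{\mu,m}(f)=\frac{1}{m!(m-1)!}\int_{\mathbb D}|f^{(m)}(z)|^2P_\mu(z)(1-|z|^2)^{m-1}\,dA(z),\qquad P_\mu(z)=\int_{\mathbb T}\frac{1-|z|^2}{|z-\zeta|^2}\,d\mu(\zeta),$$ where $dA$ is Lebesgue area measure on $\mathbb D$ normalized so that $\mathbb D$ has measure $1$ and $f^{(m)}$ is the $m$-th derivative. For $\mu\neq0$, $\mathcal H_{\mu,m}=\{f\in\mathcal O(\mathbb D):D_{\mu,m}(f)<\infty\}$; for $\mu=0$, $\mathcal H_{\mu,m}=H^2$, the Hardy space on $\mathbb D$. It is known that $\mathcal H_{\mu,m}\subseteq H^2$, and the norm on $\mathcal H_{\mu,m}$ is given by $\|f\|_{\mu,m}^2=\|f\|_{H^2}^2+D_{\mu,m}(f)$. For $f(z)=\sum_{k\ge0}a_kz^k\in\mathcal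 O(\mathbb D)$, $\alpha\geqslant0$ and an integer $n\geqslant 0$, the generalized $n$-th Cesàro mean is $$\sigma_n^\alpha[f](z)=\binom{n+\alpha}{\alpha}^{-1}\sum_{k=0}^n\binom{n-k+\alpha}{\alpha}a_kz^k,\qquad \binom{j+\alpha}{\alpha}:=\frac{\Gamma(j+\alpha+1)}{\Gamma(\alpha+1)\Gamma(j+1)}.$$ *)

theory Defs
  imports "HOL-Complex_Analysis.Complex_Analysis"
begin

definition circle_measures :: "complex measure set" where
  "circle_measures =
     {\<mu>. finite_measure \<mu> \<and> sets \<mu> = sets (restrict_space borel (sphere 0 1))}"

definition disc_area :: "complex measure" where
  "disc_area = uniform_measure lborel (ball 0 1)"

definition poisson_integral :: "complex measure \<Rightarrow> complex \<Rightarrow> ennreal" where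
  "poisson_integral \<mu> z =
     (\<integral>\<^sup>+ \<zeta>. ennreal ((1 - (cmod z)\<^sup>2) / (cmod (z - \<zeta>))\<^sup>2) \<partial>\<mu>)"

text \<open>
  Values are extended non-negative reals. A function that is holomorphic on the disc is a total
  function with arbitrary values elsewhere; only its values on the disc enter the definitions.
\<close>

definition dirichlet_integral :: "complex measure \<Rightarrow> nat \<Rightarrow> (complex \<Rightarrow> complex) \<Rightarrow> ennreal" where
  "dirichlet_integral \<mu> m f =
     ennreal (1 / (fact m * fact (m - 1))) *
     (\<integral>\<^sup>+ z \<in> ball 0 1. ennreal ((cmod ((deriv ^^ m) f z))\<^sup>2) * poisson_integral \<mu> z *
        ennreal ((1 - (cmod z)\<^sup>2) ^ (m - 1)) \<partial>disc_area)"

definition hardy_norm_sq :: "(complex \<Rightarrow> complex) \<Rightarrow> ennreal" where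
  "hardy_norm_sq f =
     (SUP r \<in> {0..<1::real}.
        (\<integral>\<^sup>+ t \<in> {0..2 * pi}. ennreal ((cmod (f (of_real r * cis t)))\<^sup>2) \<partial>lborel) /
        ennreal (2 * pi))"

definition hardy_space :: "(complex \<Rightarrow> complex) set" where
  "hardy_space = {f. f holomorphic_on ball 0 1 \<and> hardy_norm_sq f < \<infinity>}"

definition dirichlet_space :: "complex measure \<Rightarrow> nat \<Rightarrow> (complex \<Rightarrow> complex) set" where
  "dirichlet_space \<mu> m =
     (if emeasure \<mu> (space \<mu>) = 0 then hardy_space
      else {f. f holomorphic_on ball 0 1 \<and> dirichlet_integral \<mu> m f < \<infinity>})"

text \<open>
  The norm is infinite, rather than a junk real value, when its square is infinite, so that
  convergence of norms to zero includes that they are eventually finite.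
\<close>

definition dirichlet_norm :: "complex measure \<Rightarrow> nat \<Rightarrow> (complex \<Rightarrow> complex) \<Rightarrow> ennreal" where
  "dirichlet_norm \<mu> m f =
     (let N = hardy_norm_sq f + dirichlet_integral \<mu> m f
      in if N = \<infinity> then \<infinity> else ennreal (sqrt (enn2real N)))"

definition cesaro_binomial :: "nat \<Rightarrow> real \<Rightarrow> real" where
  "cesaro_binomial j \<alpha> =
     Gamma (real j + \<alpha> + 1) / (Gamma (\<alpha> + 1) * Gamma (real j + 1))"

definition cesaro_mean :: "nat \<Rightarrow> real \<Rightarrow> (complex \<Rightarrow> complex) \<Rightarrow> complex \<Rightarrow> complex" where
  "cesaro_mean n \<alpha> f z =
     inverse (of_real (cesaro_binomial n \<alpha>)) *
     (\<Sum>k\<le>n. of_real (cesaro_binomial (n - k) \<alpha>) * fps_nth (fps_expansion f 0) k * z ^ k)"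

end

theory Submission
  imports Defs
begin

text \<open>
  Fix a point \<open>\<zeta>\<close> of the circle, write \<open>f z = (\<Sum>k. a k * z ^ k)\<close> and
  \<open>S k = (\<Sum>j\<le>k. \<zeta> ^ j * (j + m)! / j! * a (j + m))\<close>. Up to sign and a unimodular factor, \<open>S k\<close>
  is the \<open>k\<close>-th Taylor coefficient of the \<open>m\<close>-th derivative of \<open>f\<close> divided by \<open>z - \<zeta>\<close>, so by
  Tonelli and orthogonality of the monomials on the disc \<open>(m - 1)! D f\<close> is the sum over \<open>k\<close> of
  \<open>w k = k! / (k + m + 1)!\<close> times the integral of \<open>|S k|\<^sup>2\<close> with respect to \<open>\<mu>\<close>.
  A Cesaro mean multiplies \<open>a k\<close> by \<open>c k\<close>, and summation by parts turns the sums \<open>S k\<close> of the error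
  into \<open>(c (k + m) - 1) * S k\<close> plus a combination of the \<open>S j\<close>, \<open>j < k\<close>, with coefficients
  \<open>c (j + m) - c (j + m + 1)\<close>. The squares of these differences sum to \<open>O(1/n)\<close> exactly when
  \<open>\<alpha> > 1/2\<close>; together with the tail estimate \<open>(\<Sum>i>k. w i) \<le> (k + m + 1) * w k / m\<close> and
  Cauchy-Schwarz, the error is at most the original sum with its \<open>k\<close>-th term multiplied by a factor
  that is bounded and tends to \<open>0\<close> as \<open>n \<rightarrow> \<infinity>\<close>. Dominated convergence of series concludes.
\<close>

unbundle no fps_syntax

subsection \<open>Area measure on the disc\<close>

text \<open>Carries the invariance of Lebesgue measure under orthogonal maps of
  \<open>real^2\<close> over to the complex plane. Comparing boxes suffices, and the coordinate map
  matches boxes with equal side lengths.\<close>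

lemma distr_lborel_vec_complex:
  "distr lborel borel (\<lambda>x::real^2. Complex (x $ 1) (x $ 2)) = lborel"
proof (rule lborel_eqI[symmetric])
  let ?g = "\<lambda>x::real^2. Complex (x $ 1) (x $ 2)"
  have cont: "continuous_on UNIV ?g"
    by (simp add: Complex_eq continuous_intros)
  then have [measurable]: "?g \<in> borel_measurable lborel"
    by (simp add: borel_measurable_continuous_onI)
  fix l u :: complex
  assume le: "\<And>b. b \<in> Basis \<Longrightarrow> l \<bullet> b \<le> u \<bullet> b"
  then have le': "Re l \<le> Re u" "Im l \<le> Im u"
    using le[of 1] le[of \<i>] by (auto simp: Basis_complex_def)
  have "?g -` box l u = box (vector [Re l, Im l]) (vector [Re u, Im u])"
    by (auto simp: box_def Basis_complex_def Basis_vec_def inner_axis forall_2 UNIV_2 vector_2)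
  then have "emeasure (distr lborel borel ?g) (box l u) =
      emeasure lborel (box (vector [Re l, Im l]) (vector [Re u, Im u] :: real^2))"
    by (simp add: emeasure_distr)
  also have "\<dots> = (\<Prod>b\<in>Basis. (vector [Re u, Im u] - vector [Re l, Im l] :: real^2) \<bullet> b)"
    using le' by (intro emeasure_lborel_box)
      (auto simp: Basis_vec_def inner_axis UNIV_2 vector_2)
  also have "(\<Prod>b\<in>Basis. (vector [Re u, Im u] - vector [Re l, Im l] :: real^2) \<bullet> b) =
      (\<Prod>b\<in>Basis. (u - l) \<bullet> b)"
    by (simp add: Basis_vec_def Basis_complex_def UNIV_2 inner_axis axis_eq_axis)
  finally show "emeasure (distr lborel borel ?g) (box l u) = (\<Prod>b\<in>Basis. (u - l) \<bullet> b)" .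
qed simp

text \<open>In the coordinates of \<open>real^2\<close>, multiplication by a unimodular number is
  the orthogonal map \<open>?R\<close>, which preserves Lebesgue measure.\<close>

lemma distr_lborel_rotation:
  fixes c :: complex
  assumes c: "cmod c = 1"
  shows "distr lborel borel ((*) c) = lborel"
proof (rule lborel_eqI[symmetric])
  let ?g = "\<lambda>x::real^2. Complex (x $ 1) (x $ 2)"
  let ?R = "\<lambda>x::real^2. (\<chi> i. if i = 1 then Re (c * ?g x) else Im (c * ?g x)) :: real^2"
  have gR: "?g (?R x) = c * ?g x" for x
    by (simp add: complex_eq_iff)

  have nrm: "norm x = cmod (?g x)" for x
    by (simp add: norm_vec_def L2_set_def UNIV_2 cmod_def)
  have R_linear: "linear ?R"
    by (rule linearI) (simp_all add: vec_eq_iff algebra_simps)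
  have R_orth: "orthogonal_transformation ?R"
    unfolding orthogonal_transformation
  proof (intro conjI allI R_linear)
    fix v :: "real^2"
    have "norm (?R v) = cmod (?g (?R v))" by (rule nrm)
    also have "\<dots> = cmod (?g v)" unfolding gR using c by (simp only: norm_mult mult_1)
    finally show "norm (?R v) = norm v" unfolding nrm[of v] .
  qed
  have surj: "\<exists>y. ?R y = x" for x
    using surjD[OF orthogonal_transformation_surj[OF R_orth], of x] by (elim exE) (rule exI, erule sym)
  have [measurable]: "?g \<in> borel_measurable lborel" 
    by (simp add: Complex_eq borel_measurable_continuous_onI continuous_intros)
  have [measurable]: "(*) c \<in> borel_measurable lborel"
    by (simp add: borel_measurable_continuous_onI continuous_intros)
  fix l u :: complex
  assume le: "\<And>b. b \<in> Basis \<Longrightarrow> l \<bullet> b \<le> u \<bullet> b"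
  \<comment> \<open>\<open>?B\<close> is the box and \<open>?A\<close> its preimage under the
    rotation, both read in the plane; \<open>?R\<close> maps \<open>?A\<close> onto
    \<open>?B\<close>.\<close>
  let ?B = "?g -` box l u" and ?A = "?g -` ((*) c -` box l u)"
  have "open ((*) c -` box l u)"
    by (intro open_vimage open_box) (auto intro!: continuous_intros)
  then have oA: "(*) c -` box l u \<in> sets borel" by simp
  have mA: "?A \<in> sets lborel"
    using measurable_sets[OF \<open>?g \<in> borel_measurable lborel\<close> oA] by simp
  have img: "?R ` ?A = ?B"
  proof (intro equalityI subsetI)
    fix x assume x: "x \<in> ?B"
    obtain y where y: "?R y = x" using surj by blast
    then show "x \<in> ?R ` ?A" using x gR[of y] by (intro image_eqI[of _ _ y]) (simp_all del: complex_mult)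
  qed (use gR in \<open>auto simp del: complex_mult\<close>)
  \<comment> \<open>Boundedness makes the measure finite, so that the equality of the real values
    \<open>measure\<close> below lifts to \<open>emeasure\<close>.\<close>
  have "bounded ?A"
  proof -
    have "bounded (box l u)" by simp
    then obtain K where K: "\<And>z. z \<in> box l u \<Longrightarrow> cmod z \<le> K" by (auto simp: bounded_iff)
    show ?thesis unfolding bounded_iff
    proof (intro exI ballI)
      fix x assume "x \<in> ?A"
      then have "cmod (c * ?g x) \<le> K" by (intro K) (simp only: vimage_eq)
      then show "norm x \<le> K" unfolding nrm[of x] using c by (simp only: norm_mult mult_1)
    qed
  qed
  then have lm: "?A \<in> lmeasurable"
    using mA by (intro bounded_set_imp_lmeasurable) auto
  have e1: "emeasure lborel ((*) c -` box l u) = emeasure lborel ?A"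
    by (subst distr_lborel_vec_complex[symmetric], subst emeasure_distr) (use oA in auto)
  have e2: "emeasure lborel (box l u) = emeasure lborel ?B"
    by (subst distr_lborel_vec_complex[symmetric], subst emeasure_distr) auto
  have "?B \<in> lmeasurable" and "measure lebesgue ?B = measure lebesgue ?A"
    using measure_orthogonal_image[OF R_orth lm] measurable_orthogonal_image[OF R_orth lm] img by auto
  then have "emeasure lebesgue ?A = emeasure lebesgue ?B"
    using lm by (simp add: emeasure_eq_measure2 fmeasurableD2)
  moreover have "?B \<in> sets lborel"
    using measurable_sets[OF \<open>?g \<in> borel_measurable lborel\<close>, of "box l u"] by simp
  ultimately have "emeasure lborel ?A = emeasure lborel ?B"
    using mA by simp
  then show "emeasure (distr lborel borel ((*) c)) (box l u) = (\<Prod>b\<in>Basis. (u - l) \<bullet> b)"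
    using e1 e2 le by (simp add: emeasure_distr)
qed simp

lemma nn_integral_disc_area:
  assumes [measurable]: "f \<in> borel_measurable borel"
  shows "(\<integral>\<^sup>+z. f z \<partial>disc_area) = (\<integral>\<^sup>+z. f z * indicator (ball 0 1) z \<partial>lborel) / ennreal pi"
  unfolding disc_area_def
  by (subst nn_integral_uniform_measure)
    (auto simp: emeasure_ball eval_unit_ball_vol)

text \<open>Allows a disc integral to be averaged over all rotations, which brings in Parseval on
  circles.\<close>

lemma nn_integral_disc_area_rotation:
  assumes [measurable]: "f \<in> borel_measurable borel" and c: "cmod c = 1"
  shows "(\<integral>\<^sup>+z. f (c * z) \<partial>disc_area) = (\<integral>\<^sup>+z. f z \<partial>disc_area)"
proof -
  have [measurable]: "ball 0 1 \<in> sets (borel :: complex measure)"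
    by simp
  have "(\<integral>\<^sup>+z. f z * indicator (ball 0 1) z \<partial>lborel) =
      (\<integral>\<^sup>+z. f z * indicator (ball 0 1) z \<partial>(distr lborel borel ((*) c)))"
    by (simp add: distr_lborel_rotation[OF c])
  also have "\<dots> = (\<integral>\<^sup>+z. f (c * z) * indicator (ball 0 1) (c * z) \<partial>lborel)"
    by (subst nn_integral_distr) auto
  also have "(\<lambda>z. indicator (ball 0 1) (c * z) :: ennreal) = indicator (ball 0 1)"
    using c by (auto simp: indicator_def norm_mult)
  finally show ?thesis
    by (simp add: nn_integral_disc_area)
qed

text \<open>In normalized area the disc of radius \<open>sqrt x\<close> has mass \<open>x\<close>,
  so the square of \<open>cmod z\<close> is uniformly distributed on the unit interval. This takes
  the place of polar coordinates.\<close>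

lemma distr_disc_area_cmod_sq:
  "distr disc_area borel (\<lambda>z. (cmod z)\<^sup>2) = density lborel (indicator {0<..<1})"
proof (rule measure_eqI_lessThan)
  have [simp]: "sets disc_area = sets borel" "space disc_area = UNIV"
    by (simp_all add: disc_area_def)
  have [measurable]: "(\<lambda>z. (cmod z)\<^sup>2) \<in> borel_measurable disc_area"
    by (simp add: disc_area_def)
  fix x :: real
  have e: "emeasure (distr disc_area borel (\<lambda>z. (cmod z)\<^sup>2)) {x<..} =
      emeasure lborel (ball (0::complex) 1 \<inter> {z. x < (cmod z)\<^sup>2}) / ennreal pi"
    by (simp add: emeasure_distr vimage_def disc_area_def emeasure_ball eval_unit_ball_vol)
  have d: "emeasure (density lborel (indicator {0<..<1})) {x<..} = emeasure lborel ({x<..} \<inter> {0<..<1})"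
    by (simp add: emeasure_density Int_commute flip: indicator_inter_arith)
  show "emeasure (distr disc_area borel (\<lambda>z. (cmod z)\<^sup>2)) {x<..} < \<infinity>"
  proof -
    have "emeasure lborel (ball (0::complex) 1 \<inter> {z. x < (cmod z)\<^sup>2}) \<le> emeasure lborel (ball (0::complex) 1)"
      by (intro emeasure_mono) auto
    also have "\<dots> < \<infinity>" using emeasure_lborel_ball_finite .
    finally show ?thesis unfolding e infinity_ennreal_def
      by (metis ennreal_divide_eq_top_iff ennreal_eq_0_iff not_le pi_gt_zero top.not_eq_extremum)
  qed
  consider "x < 0" | "0 \<le> x" "x < 1" | "x \<ge> 1" by linarith
  then show "emeasure (distr disc_area borel (\<lambda>z. (cmod z)\<^sup>2)) {x<..} =
      emeasure (density lborel (indicator {0<..<1})) {x<..}"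
  proof cases
    case 1
    then have "ball (0::complex) 1 \<inter> {z. x < (cmod z)\<^sup>2} = ball 0 1"
      by (auto intro: less_le_trans[OF _ zero_le_power2])
    moreover have "{x<..} \<inter> {0<..<1} = {0<..<1}" using 1 by auto
    ultimately show ?thesis unfolding d e
      by (simp add: emeasure_ball eval_unit_ball_vol ennreal_divide_self)
  next
    case 2
    have "ball (0::complex) 1 \<inter> {z. x < (cmod z)\<^sup>2} = ball 0 1 - cball 0 (sqrt x)"
    proof -
      have "cmod z \<le> sqrt x \<longleftrightarrow> (cmod z)\<^sup>2 \<le> x" for z
        using real_sqrt_le_iff[of "(cmod z)\<^sup>2" x] by simp
      then show ?thesis unfolding set_eq_iff by (simp add: not_le[symmetric])
    qed
    moreover have "{x<..} \<inter> {0<..<1} = {x<..<1}" using 2 by auto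
    moreover have "emeasure lborel (ball 0 1 - cball 0 (sqrt x)::complex set) = ennreal (pi * (1 - x))"
    proof -
      have "emeasure lborel (ball 0 1 - cball 0 (sqrt x)::complex set) =
          emeasure lborel (ball 0 1::complex set) - emeasure lborel (cball 0 (sqrt x)::complex set)"
        using 2 by (intro emeasure_Diff)
          (auto simp: emeasure_cball, smt (verit) real_sqrt_lt_1_iff)
      also have "\<dots> = ennreal pi - ennreal (pi * x)"
        using 2 by (simp add: emeasure_ball emeasure_cball eval_unit_ball_vol)
      also have "\<dots> = ennreal (pi * (1 - x))"
        using 2 by (subst ennreal_minus) (auto simp: algebra_simps)
      finally show ?thesis .
    qed
    ultimately show ?thesis unfolding d e using 2
      by (simp add: divide_ennreal)
  next
    case 3
    then have "ball (0::complex) 1 \<inter> {z. x < (cmod z)\<^sup>2} = {}"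
      by (auto simp: not_less) (smt (verit) norm_ge_zero power_le_one)
    moreover have "{x<..} \<inter> {0<..<1} = {}" using 3 by auto
    ultimately show ?thesis unfolding d e by simp
  qed
qed (simp_all add: disc_area_def)

lemma nn_integral_power_beta:
  "(\<integral>\<^sup>+s. ennreal (s ^ k * (1 - s) ^ m) * indicator {0<..<1} s \<partial>lborel) =
     ennreal (fact k * fact m / fact (k + m + 1))"
proof -
  \<comment> \<open>The interval is open because \<open>powr\<close> and \<open>^\<close> disagree
    at the endpoints: \<open>0 powr 0 = 0\<close> but \<open>0 ^ 0 = 1\<close>.\<close>
  have "((\<lambda>t. t powr (real (k+1) - 1) * (1 - t) powr (real (m+1) - 1)) has_integral Beta (real (k+1)) (real (m+1))) {0<..<1}"
    using has_integral_Beta_real[of "real (k+1)" "real (m+1)"]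
    by (simp add: has_integral_Icc_iff_Ioo)
  also have "Beta (real (k+1)) (real (m+1)) = fact k * fact m / fact (k + m + 1)"
    unfolding Beta_def using Gamma_fact[of k, where 'a=real] Gamma_fact[of m, where 'a=real] Gamma_fact[of "k+m+1", where 'a=real]
    by (simp add: add_ac)
  finally have "((\<lambda>t. t ^ k * (1 - t) ^ m) has_integral (fact k * fact m / fact (k + m + 1))) {0<..<1::real}"
    by (rule has_integral_eq[rotated]) (auto simp: powr_realpow)
  then have h: "((\<lambda>t. if t \<in> {0<..<1} then t ^ k * (1 - t) ^ m else 0) has_integral (fact k * fact m / fact (k + m + 1))) (UNIV::real set)"
    by (simp only: has_integral_restrict_UNIV)
  have "(\<integral>\<^sup>+s. ennreal (s ^ k * (1 - s) ^ m) * indicator {0<..<1} s \<partial>lborel) = (\<integral>\<^sup>+s. ennreal (if s \<in> {0<..<1} then s ^ k * (1 - s) ^ m else 0) \<partial>lborel)"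
    by (intro nn_integral_cong) (auto simp: indicator_def)
  also have "\<dots> = ennreal (fact k * fact m / fact (k + m + 1))"
    by (rule nn_integral_has_integral_lborel[OF _ _ h]) auto
  finally show ?thesis .
qed

lemma nn_integral_disc_area_radial:
  "(\<integral>\<^sup>+z. ennreal ((cmod z)\<^sup>2 ^ k * (1 - (cmod z)\<^sup>2) ^ m) \<partial>disc_area) =
     ennreal (fact k * fact m / fact (k + m + 1))"
proof -
  have [measurable]: "(\<lambda>z. (cmod z)\<^sup>2) \<in> borel_measurable disc_area"
    by (simp add: disc_area_def)
  have "(\<integral>\<^sup>+z. ennreal ((cmod z)\<^sup>2 ^ k * (1 - (cmod z)\<^sup>2) ^ m) \<partial>disc_area) =
      (\<integral>\<^sup>+s. ennreal (s ^ k * (1 - s) ^ m) \<partial>distr disc_area borel (\<lambda>z. (cmod z)\<^sup>2))"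
    by (subst nn_integral_distr) auto
  also have "\<dots> = ennreal (fact k * fact m / fact (k + m + 1))"
    unfolding distr_disc_area_cmod_sq nn_integral_power_beta[symmetric]
    by (subst nn_integral_density) (auto simp: mult.commute)
  finally show ?thesis .
qed

subsection \<open>Parseval on circles\<close>

lemma has_integral_cis_period:
  fixes j k :: nat
  shows "((\<lambda>t. cis t ^ j * cnj (cis t ^ k)) has_integral (if j = k then of_real (2 * pi) else 0)) {0..2 * pi}"
proof (cases "j = k")
  case True
  have "((\<lambda>t. 1 :: complex) has_integral of_real (2 * pi)) {0..2 * pi}"
    using has_integral_const_real[of "1::complex" 0 "2 * pi"] by (simp add: scaleR_conv_of_real)
  with True show ?thesis
    by (simp flip: power_mult_distrib add: cis_mult cis_cnj)
next
  case False
  \<comment> \<open>The product is \<open>exp (c * t)\<close> with antiderivative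
    \<open>exp (c * t) / c\<close>; since \<open>c\<close> is an integer multiple of
    \<open>\<i>\<close>, both endpoint values agree.\<close>
  define c where "c = \<i> * (of_nat j - of_nat k)"
  have c: "c \<noteq> 0" using False by (simp add: c_def)
  have eq: "cis t ^ j * cnj (cis t ^ k) = exp (c * of_real t)" for t
    unfolding Complex.DeMoivre cis_cnj cis_mult unfolding cis_conv_exp
    by (simp add: c_def algebra_simps)
  have "((\<lambda>t. exp (c * of_real t)) has_integral
      exp (c * of_real (2 * pi)) / c - exp (c * of_real 0) / c) {0..2 * pi}"
    using c
    by (intro fundamental_theorem_of_calculus)
      (auto intro!: derivative_eq_intros has_vector_derivative_real_field)
  moreover have "exp (c * of_real (2 * pi)) = 1"
    unfolding exp_eq_1 c_def by (auto intro!: exI[of _ "int j - int k"])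
  ultimately show ?thesis
    using False unfolding eq by simp
qed

lemma has_integral_trig_poly_sq:
  fixes c :: "nat \<Rightarrow> complex"
  shows "((\<lambda>t. (cmod (\<Sum>k<N. c k * cis t ^ k))\<^sup>2) has_integral
     2 * pi * (\<Sum>k<N. (cmod (c k))\<^sup>2)) {0..2 * pi}"
proof -
  have "((\<lambda>t. \<Sum>j<N. \<Sum>k<N. (c j * cnj (c k)) * (cis t ^ j * cnj (cis t ^ k))) has_integral
     (\<Sum>j<N. \<Sum>k<N. (c j * cnj (c k)) * (if j = k then of_real (2 * pi) else 0))) {0..2 * pi}"
    by (intro has_integral_sum has_integral_mult_right has_integral_cis_period) auto
  also have "(\<Sum>j<N. \<Sum>k<N. (c j * cnj (c k)) * (if j = k then of_real (2 * pi) else 0)) =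
      of_real (2 * pi * (\<Sum>k<N. (cmod (c k))\<^sup>2))"
    by (simp add: sum_distrib_left complex_norm_square[symmetric] if_distrib[of "\<lambda>x. _ * x"] cong: if_cong)
      (simp add: complex_norm_square mult_ac)
  also have "(\<lambda>t. \<Sum>j<N. \<Sum>k<N. (c j * cnj (c k)) * (cis t ^ j * cnj (cis t ^ k))) =
      (\<lambda>t. of_real ((cmod (\<Sum>k<N. c k * cis t ^ k))\<^sup>2))"
    unfolding complex_norm_square by (simp add: sum_product mult_ac)
  finally have "((\<lambda>t. Re (of_real ((cmod (\<Sum>k<N. c k * cis t ^ k))\<^sup>2))) has_integral
      Re (of_real (2 * pi * (\<Sum>k<N. (cmod (c k))\<^sup>2)))) {0..2 * pi}"
    by (rule has_integral_Re)
  then show ?thesis by simp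
qed

text \<open>The identity for trigonometric polynomials passes to the limit by dominated convergence:
  every partial sum is bounded by the constant \<open>M\<close>, the sum of the norms of the
  coefficients.\<close>

lemma nn_integral_parseval:
  fixes c :: "nat \<Rightarrow> complex"
  assumes c: "summable (\<lambda>k. cmod (c k))"
  shows "(\<integral>\<^sup>+t\<in>{0..2 * pi}. ennreal ((cmod (\<Sum>k. c k * cis t ^ k))\<^sup>2) \<partial>lborel) =
    ennreal (2 * pi) * (\<Sum>k. ennreal ((cmod (c k))\<^sup>2))"
proof -
  define F where "F = (\<lambda>N t. \<Sum>k<N. c k * cis t ^ k)"
  define M where "M = (\<Sum>k. cmod (c k))"
  have cont: "continuous_on UNIV (F N)" for N
    unfolding F_def cis_conv_exp by (intro continuous_intros)
  then have [measurable]: "F N \<in> borel_measurable lborel" for N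
    by (simp add: borel_measurable_continuous_onI)
  have bnd: "cmod (F N t) \<le> M" for N t
  proof -
    have "cmod (F N t) \<le> (\<Sum>k<N. cmod (c k))"
      unfolding F_def by (intro sum_norm_le) (simp add: norm_mult norm_power)
    also have "\<dots> \<le> M" unfolding M_def by (intro sum_le_suminf c) auto
    finally show ?thesis .
  qed
  have "summable (\<lambda>k. c k * cis t ^ k)" for t
    by (rule summable_norm_cancel) (simp add: norm_mult norm_power c)
  then have lim: "(\<lambda>N. F N t) \<longlonglongrightarrow> (\<Sum>k. c k * cis t ^ k)" for t
    unfolding F_def by (rule summable_LIMSEQ)
  have int: "(\<integral>\<^sup>+t\<in>{0..2 * pi}. ennreal ((cmod (F N t))\<^sup>2) \<partial>lborel) =
      ennreal (2 * pi) * (\<Sum>k<N. ennreal ((cmod (c k))\<^sup>2))" for N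
  proof -
    have "((\<lambda>t. if t \<in> {0..2 * pi} then (cmod (F N t))\<^sup>2 else 0) has_integral
        2 * pi * (\<Sum>k<N. (cmod (c k))\<^sup>2)) UNIV"
      unfolding has_integral_restrict_UNIV F_def by (rule has_integral_trig_poly_sq)
    then have "(\<integral>\<^sup>+t. ennreal (if t \<in> {0..2 * pi} then (cmod (F N t))\<^sup>2 else 0) \<partial>lborel) =
        ennreal (2 * pi * (\<Sum>k<N. (cmod (c k))\<^sup>2))"
      by (intro nn_integral_has_integral_lborel) auto
    moreover have "(\<integral>\<^sup>+t. ennreal (if t \<in> {0..2 * pi} then (cmod (F N t))\<^sup>2 else 0) \<partial>lborel) = 
       (\<integral>\<^sup>+t\<in>{0..2 * pi}. ennreal ((cmod (F N t))\<^sup>2) \<partial>lborel)"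
      by (intro nn_integral_cong) (auto simp: indicator_def)
    ultimately show ?thesis
      by (simp add: ennreal_mult' sum_nonneg flip: sum_ennreal)
  qed
  have "(\<lambda>N. \<integral>\<^sup>+t\<in>{0..2 * pi}. ennreal ((cmod (F N t))\<^sup>2) \<partial>lborel) \<longlonglongrightarrow>
      (\<integral>\<^sup>+t\<in>{0..2 * pi}. ennreal ((cmod (\<Sum>k. c k * cis t ^ k))\<^sup>2) \<partial>lborel)"
  proof (rule nn_integral_dominated_convergence[where w = "\<lambda>t. ennreal (M\<^sup>2) * indicator {0..2 * pi} t"])
    show "(\<lambda>t. ennreal ((cmod (\<Sum>k. c k * cis t ^ k))\<^sup>2) * indicator {0..2 * pi} t) \<in> borel_measurable lborel"
      using borel_measurable_LIMSEQ_metric[of F lborel, OF _ lim] by measurable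
    show "(\<integral>\<^sup>+t. ennreal (M\<^sup>2) * indicator {0..2 * pi} t \<partial>lborel) < \<infinity>"
      by (simp add: nn_integral_cmult_indicator ennreal_mult_less_top)
    show "AE t in lborel. ennreal ((cmod (F N t))\<^sup>2) * indicator {0..2 * pi} t \<le> ennreal (M\<^sup>2) * indicator {0..2 * pi} t" for N
      using bnd by (intro AE_I2 mult_right_mono ennreal_leI power_mono) auto
    show "AE t in lborel. (\<lambda>N. ennreal ((cmod (F N t))\<^sup>2) * indicator {0..2 * pi} t) \<longlonglongrightarrow>
        ennreal ((cmod (\<Sum>k. c k * cis t ^ k))\<^sup>2) * indicator {0..2 * pi} t"
      by (intro AE_I2 tendsto_intros lim) (auto simp: indicator_def intro!: tendsto_intros lim)
  qed measurable
  moreover have "(\<lambda>N. ennreal (2 * pi) * (\<Sum>k<N. ennreal ((cmod (c k))\<^sup>2))) \<longlonglongrightarrow>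
      ennreal (2 * pi) * (\<Sum>k. ennreal ((cmod (c k))\<^sup>2))"
    by (intro ennreal_tendsto_cmult summable_LIMSEQ) auto
  ultimately show ?thesis
    unfolding int by (rule LIMSEQ_unique)
qed

text \<open>Convergence at a real point \<open>r\<close> strictly between \<open>cmod z\<close> and
  1 forces absolute convergence at \<open>z\<close>.\<close>

lemma summable_norm_power_series_disc:
  fixes a :: "nat \<Rightarrow> complex"
  assumes "\<And>z. cmod z < 1 \<Longrightarrow> (\<lambda>k. a k * z ^ k) sums f z" and "cmod z < 1"
  shows "summable (\<lambda>k. cmod (a k * z ^ k))"
proof -
  obtain r where r: "cmod z < r" "r < 1" using dense[OF assms(2)] by blast
  then have "cmod (of_real r) < 1" using norm_ge_zero[of z] by (simp del: norm_ge_zero)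
  then have "summable (\<lambda>k. a k * of_real r ^ k)" using assms(1) by (blast dest: sums_summable)
  then show ?thesis using r norm_ge_zero[of z] by (intro powser_insidea[of _ "of_real r"]) auto
qed

text \<open>Parseval for the coefficients \<open>a k * z ^ k\<close>. A fixed point \<open>z\<close>
  is rotated, rather than a radius fixed, because averaging a disc integral over rotations produces
  exactly this inner integral.\<close>

lemma nn_integral_power_series_circle:
  fixes a :: "nat \<Rightarrow> complex"
  assumes f: "\<And>z. cmod z < 1 \<Longrightarrow> (\<lambda>k. a k * z ^ k) sums f z" and z: "cmod z < 1"
  shows "(\<integral>\<^sup>+t\<in>{0..2 * pi}. ennreal ((cmod (f (cis t * z)))\<^sup>2) \<partial>lborel) =
    ennreal (2 * pi) * (\<Sum>k. ennreal ((cmod (a k))\<^sup>2 * (cmod z)\<^sup>2 ^ k))"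
proof -
  have 1: "f (cis t * z) = (\<Sum>k. a k * z ^ k * cis t ^ k)" for t
  proof -
    have "(\<lambda>k. a k * (cis t * z) ^ k) sums f (cis t * z)"
      using z by (intro f) (simp add: norm_mult)
    then show ?thesis by (simp add: sums_iff power_mult_distrib mult_ac)
  qed
  have 2: "(cmod (a k * z ^ k))\<^sup>2 = (cmod (a k))\<^sup>2 * (cmod z)\<^sup>2 ^ k" for k
    by (simp only: norm_mult norm_power power_mult_distrib power_mult[symmetric] mult.commute[of k 2])
  show ?thesis
    using nn_integral_parseval[OF summable_norm_power_series_disc[OF f z]] unfolding 1 2 .
qed

text \<open>The mean over the circle of radius \<open>r\<close> is \<open>A r\<close>, which lies
  termwise below the full sum. Conversely each finite partial sum of the full series is the limit of
  partial sums of \<open>A r\<close> along radii tending to 1, an argument that also covers an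
  infinite value.\<close>

lemma hardy_norm_sq_power_series:
  fixes a :: "nat \<Rightarrow> complex"
  assumes f: "\<And>z. cmod z < 1 \<Longrightarrow> (\<lambda>k. a k * z ^ k) sums f z"
  shows "hardy_norm_sq f = (\<Sum>k. ennreal ((cmod (a k))\<^sup>2))"
proof -
  define A where "A = (\<lambda>r::real. \<Sum>k. ennreal ((cmod (a k))\<^sup>2 * r\<^sup>2 ^ k))"
  have *: "(\<integral>\<^sup>+ t \<in> {0..2 * pi}. ennreal ((cmod (f (of_real r * cis t)))\<^sup>2) \<partial>lborel) /
        ennreal (2 * pi) = A r" if "r \<in> {0..<1}" for r
  proof -
    have "(\<integral>\<^sup>+ t \<in> {0..2 * pi}. ennreal ((cmod (f (of_real r * cis t)))\<^sup>2) \<partial>lborel) = ennreal (2 * pi) * A r"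
    proof -
      have r: "cmod (of_real r) < 1"
        using that by auto
      have comm: "of_real r * cis t = cis t * of_real r" for t
        by (rule mult.commute)
      show ?thesis
        using nn_integral_power_series_circle[OF f r]
        unfolding comm A_def norm_of_real power2_abs .
    qed
    then show ?thesis
      unfolding mult.commute[of "ennreal (2 * pi)" "A r"]
      by (simp only:) (rule ennreal_mult_divide_eq, auto)
  qed
  have eq: "hardy_norm_sq f = (SUP r\<in>{0..<1}. A r)"
    unfolding hardy_norm_sq_def by (intro SUP_cong) (use * in auto)
  show ?thesis
  proof (rule antisym)
    show "hardy_norm_sq f \<le> (\<Sum>k. ennreal ((cmod (a k))\<^sup>2))"
      unfolding eq A_def
    proof (intro SUP_least suminf_le ennreal_leI)
      fix r :: real and k assume "r \<in> {0..<1}"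
      then have "r\<^sup>2 ^ k \<le> 1" by (intro power_le_one) auto
      then show "(cmod (a k))\<^sup>2 * r\<^sup>2 ^ k \<le> (cmod (a k))\<^sup>2"
        by (intro mult_left_le) auto
    qed (rule summableI)+
    show "(\<Sum>k. ennreal ((cmod (a k))\<^sup>2)) \<le> hardy_norm_sq f"
    proof (rule suminf_le_const)
      fix N
      let ?r = "\<lambda>n. 1 - inverse (real (Suc n))"
      have "(\<Sum>k<N. ennreal ((cmod (a k))\<^sup>2 * (?r n)\<^sup>2 ^ k)) \<le> hardy_norm_sq f" for n
      proof -
        have "?r n \<in> {0..<1}" using inverse_le_1_iff[of "real (Suc n)"] by simp
        then have "A (?r n) \<le> hardy_norm_sq f" unfolding eq by (rule SUP_upper)
        moreover have "(\<Sum>k<N. ennreal ((cmod (a k))\<^sup>2 * (?r n)\<^sup>2 ^ k)) \<le> A (?r n)"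
          unfolding A_def by (intro sum_le_suminf) auto
        ultimately show ?thesis by simp
      qed
      moreover have "(\<lambda>n. \<Sum>k<N. ennreal ((cmod (a k))\<^sup>2 * (?r n)\<^sup>2 ^ k)) \<longlonglongrightarrow>
          (\<Sum>k<N. ennreal ((cmod (a k))\<^sup>2 * 1\<^sup>2 ^ k))"
      proof -
        have "?r \<longlonglongrightarrow> 1"
          using LIMSEQ_inverse_real_of_nat_add_minus[of 1] by simp
        then show ?thesis
          by (intro tendsto_sum tendsto_ennrealI tendsto_mult tendsto_const tendsto_power)
      qed
      ultimately show "(\<Sum>k<N. ennreal ((cmod (a k))\<^sup>2)) \<le> hardy_norm_sq f"
        by (intro LIMSEQ_le_const2[where a = "hardy_norm_sq f"]) auto
    qed simp
  qed
qed

subsection \<open>The Dirichlet integral in terms of Taylor coefficients\<close>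

lemma finite_measure_disc_area: "finite_measure disc_area"
proof (rule finite_measureI)
  have "emeasure disc_area (space disc_area) = ennreal pi / ennreal pi"
    unfolding disc_area_def
    by (subst emeasure_uniform_measure) (auto simp: emeasure_ball eval_unit_ball_vol)
  then show "emeasure disc_area (space disc_area) \<noteq> \<infinity>"
    by (simp add: divide_ennreal)
qed

lemma power_series_disc_holomorphic:
  fixes a :: "nat \<Rightarrow> complex"
  assumes f: "\<And>z. cmod z < 1 \<Longrightarrow> (\<lambda>k. a k * z ^ k) sums f z"
  shows "f holomorphic_on ball 0 1"
  using f by (intro power_series_holomorphic[of 0 1 a f]) auto

text \<open>After averaging over rotations, Tonelli moves the angular integral inside, where
  Parseval removes all cross terms. The radial moments that remain are beta values.\<close>

lemma nn_integral_power_series_disc: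
  fixes a :: "nat \<Rightarrow> complex"
  assumes f: "\<And>z. cmod z < 1 \<Longrightarrow> (\<lambda>k. a k * z ^ k) sums f z"
  shows "(\<integral>\<^sup>+z\<in>ball 0 1. ennreal ((cmod (f z))\<^sup>2 * (1 - (cmod z)\<^sup>2) ^ m) \<partial>disc_area) =
    (\<Sum>k. ennreal ((cmod (a k))\<^sup>2 * (fact k * fact m / fact (k + m + 1))))"
proof -
  interpret D: finite_measure disc_area by (rule finite_measure_disc_area)
  interpret P: pair_sigma_finite lborel disc_area
    by (intro pair_sigma_finite.intro D.sigma_finite_measure_axioms sigma_finite_lborel)
  have [simp, measurable_cong]: "sets disc_area = sets borel"
    by (simp add: disc_area_def)
  let ?w = "\<lambda>z. (1 - (cmod z)\<^sup>2) ^ m"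
  \<comment> \<open>\<open>f\<close> is arbitrary off the disc, so it is cut off there to make the
    integrand Borel measurable on the whole plane.\<close>
  define G where "G = (\<lambda>z. ennreal ((cmod (indicator (ball 0 1) z *\<^sub>R f z))\<^sup>2 * ?w z) * indicator (ball 0 1) z)"
  have [measurable]: "ball 0 1 \<in> sets (borel :: complex measure)" by simp
  have "continuous_on (ball 0 1) f"
    using power_series_disc_holomorphic[OF f] by (rule holomorphic_on_imp_continuous_on)
  then have [measurable]: "(\<lambda>z. indicator (ball 0 1) z *\<^sub>R f z) \<in> borel_measurable borel"
    by (intro borel_measurable_continuous_on_indicator) auto
  have G[measurable]: "G \<in> borel_measurable borel"
    unfolding G_def by measurable
  have cis_meas[measurable]: "cis \<in> borel_measurable borel"
    by (intro borel_measurable_continuous_onI continuous_intros)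
  have Geq: "G z = ennreal ((cmod (f z))\<^sup>2 * ?w z) * indicator (ball 0 1) z" for z
    by (simp add: G_def indicator_def)
  have w: "?w z \<ge> 0" if "cmod z < 1" for z
    using that by (simp add: abs_square_le_1)
  \<comment> \<open>The integrand is constant in \<open>t\<close>. Rotation invariance then replaces
    \<open>z\<close> by \<open>cis t * z\<close> separately for each \<open>t\<close>, and the
    factor \<open>2 * pi\<close> is cancelled at the end.\<close>
  have start: "(\<integral>\<^sup>+t\<in>{0..2 * pi}. (\<integral>\<^sup>+z. G z \<partial>disc_area) \<partial>lborel) = ennreal (2 * pi) * (\<integral>\<^sup>+z. G z \<partial>disc_area)"
    by (subst nn_integral_cmult_indicator) (auto simp: mult.commute)
  have radial: "(\<integral>\<^sup>+z. ennreal ((cmod z)\<^sup>2 ^ k * ?w z) * indicator (ball 0 1) z \<partial>disc_area) =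
      ennreal (fact k * fact m / fact (k + m + 1))" for k
    unfolding nn_integral_disc_area_radial[symmetric]
    by (simp add: nn_integral_disc_area mult.assoc flip: indicator_inter_arith)
  have "(\<integral>\<^sup>+t\<in>{0..2 * pi}. (\<integral>\<^sup>+z. G z \<partial>disc_area) \<partial>lborel) =
      (\<integral>\<^sup>+t. (\<integral>\<^sup>+z. G (cis t * z) * indicator {0..2 * pi} t \<partial>disc_area) \<partial>lborel)"
    by (simp add: nn_integral_multc nn_integral_disc_area_rotation)
  also have "\<dots> = (\<integral>\<^sup>+z. (\<integral>\<^sup>+t. G (cis t * z) * indicator {0..2 * pi} t \<partial>lborel) \<partial>disc_area)"
    by (intro P.Fubini'[symmetric]) measurable
  also have "\<dots> = (\<integral>\<^sup>+z. ennreal (2 * pi) * (\<Sum>k. ennreal ((cmod (a k))\<^sup>2) *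
      (ennreal ((cmod z)\<^sup>2 ^ k * ?w z) * indicator (ball 0 1) z)) \<partial>disc_area)"
  proof (intro nn_integral_cong)
    fix z :: complex
    show "(\<integral>\<^sup>+t. G (cis t * z) * indicator {0..2 * pi} t \<partial>lborel) =
      ennreal (2 * pi) * (\<Sum>k. ennreal ((cmod (a k))\<^sup>2) * (ennreal ((cmod z)\<^sup>2 ^ k * ?w z) * indicator (ball 0 1) z))"
    proof (cases "cmod z < 1")
      case False
      then show ?thesis by (simp add: Geq norm_mult)
    next
      case True
      have "continuous_on UNIV (\<lambda>t. indicator (ball 0 1) (cis t * z) *\<^sub>R f (cis t * z))"
      proof -
        have "continuous_on UNIV (f \<circ> (\<lambda>t. cis t * z))"
          using True by (intro continuous_on_compose continuous_intros
             continuous_on_subset[OF \<open>continuous_on (ball 0 1) f\<close>]) (auto simp: norm_mult)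
        then show ?thesis using True by (simp add: norm_mult o_def)
      qed
      then have [measurable]: "(\<lambda>t. f (cis t * z)) \<in> borel_measurable borel"
        using True by (simp add: norm_mult borel_measurable_continuous_onI)
      have "(\<integral>\<^sup>+t. G (cis t * z) * indicator {0..2 * pi} t \<partial>lborel) =
          (\<integral>\<^sup>+t. ennreal (?w z) * (ennreal ((cmod (f (cis t * z)))\<^sup>2) * indicator {0..2 * pi} t) \<partial>lborel)"
        using True w[OF True] by (intro nn_integral_cong) (simp add: Geq norm_mult ennreal_mult mult_ac)
      also have "\<dots> = ennreal (?w z) * (ennreal (2 * pi) * (\<Sum>k. ennreal ((cmod (a k))\<^sup>2 * (cmod z)\<^sup>2 ^ k)))"
        by (subst nn_integral_cmult) (measurable, simp add: nn_integral_power_series_circle[OF f True])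
      also have "\<dots> = ennreal (2 * pi) * (\<Sum>k. ennreal (?w z) * ennreal ((cmod (a k))\<^sup>2 * (cmod z)\<^sup>2 ^ k))"
        by (simp add: mult.left_commute)
      finally show ?thesis
        using True w[OF True] by (simp add: ennreal_mult mult_ac)
    qed
  qed
  also have "\<dots> = ennreal (2 * pi) * (\<Sum>k. ennreal ((cmod (a k))\<^sup>2) *
      (\<integral>\<^sup>+z. ennreal ((cmod z)\<^sup>2 ^ k * ?w z) * indicator (ball 0 1) z \<partial>disc_area))"
    by (simp add: nn_integral_cmult nn_integral_suminf)
  also have "\<dots> = ennreal (2 * pi) * (\<Sum>k. ennreal ((cmod (a k))\<^sup>2 * (fact k * fact m / fact (k + m + 1))))"
    unfolding radial
    by (intro arg_cong2[where f = "(*)"] suminf_cong refl ennreal_mult'[symmetric]) simp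
  finally have "ennreal (2 * pi) * (\<integral>\<^sup>+z. G z \<partial>disc_area) =
      ennreal (2 * pi) * (\<Sum>k. ennreal ((cmod (a k))\<^sup>2 * (fact k * fact m / fact (k + m + 1))))"
    unfolding start .
  then have "(\<integral>\<^sup>+z. G z \<partial>disc_area) =
      (\<Sum>k. ennreal ((cmod (a k))\<^sup>2 * (fact k * fact m / fact (k + m + 1))))"
    by (subst (asm) ennreal_mult_cancel_left) auto
  then show ?thesis by (simp add: Geq)
qed

text \<open>Termwise differentiation, one order at a time. The induction hypothesis on the whole
  disc also shows that the previous derivative is holomorphic, so \<open>deriv\<close> is a genuine
  derivative and not a default value.\<close>

lemma power_series_higher_deriv:
  fixes a :: "nat \<Rightarrow> complex"
  assumes f: "\<And>z. cmod z < 1 \<Longrightarrow> (\<lambda>k. a k * z ^ k) sums f z" and z: "cmod z < 1"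
  shows "(\<lambda>k. fact (k + m) / fact k * a (k + m) * z ^ k) sums (deriv ^^ m) f z"
  using z
proof (induction m arbitrary: z)
  case 0
  then show ?case using f by simp
next
  case (Suc m)
  let ?c = "\<lambda>k. fact (k + m) / fact k * a (k + m)"
  have "(deriv ^^ m) f holomorphic_on ball 0 1"
    using Suc.IH by (rule power_series_disc_holomorphic)
  then have "((deriv ^^ m) f has_field_derivative deriv ((deriv ^^ m) f) z) (at z)"
    using Suc.prems by (intro holomorphic_derivI[of _ "ball 0 1"]) auto
  then have "(\<lambda>k. diffs ?c k * z ^ k) sums deriv ((deriv ^^ m) f) z"
    using Suc.prems
    by (intro termdiffs_sums_strong[where c = ?c and f = "(deriv ^^ m) f" and K = 1] Suc.IH)
  moreover have "diffs ?c k = fact (k + Suc m) / fact k * a (k + Suc m)" for k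
    using of_nat_neq_0[of k, where 'a = complex] by (simp add: diffs_def)
  ultimately show ?case by simp
qed

text \<open>Cauchy product with the geometric series of \<open>c * z\<close>.\<close>

lemma power_series_divide_linear:
  fixes b :: "nat \<Rightarrow> complex"
  assumes g: "\<And>z. cmod z < 1 \<Longrightarrow> (\<lambda>k. b k * z ^ k) sums g z"
    and c: "cmod c = 1" and z: "cmod z < 1"
  shows "(\<lambda>k. (\<Sum>i\<le>k. b i * c ^ (k - i)) * z ^ k) sums (g z / (1 - c * z))"
proof -
  have cz: "cmod (c * z) < 1" using c z by (simp add: norm_mult)
  have "(\<lambda>k. \<Sum>i\<le>k. (b i * z ^ i) * (c * z) ^ (k - i)) sums ((\<Sum>k. b k * z ^ k) * (\<Sum>k. (c * z) ^ k))"
  proof (intro Cauchy_product_sums summable_norm_power_series_disc[OF g z])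
    show "summable (\<lambda>k. cmod ((c * z) ^ k))"
      unfolding norm_power using cz by (intro summable_geometric) simp
  qed
  also have "(\<Sum>k. b k * z ^ k) = g z" using g[OF z] by (simp add: sums_iff)
  also have "(\<Sum>k. (c * z) ^ k) = 1 / (1 - c * z)" using cz by (rule suminf_geometric)
  also have "(\<lambda>k. \<Sum>i\<le>k. (b i * z ^ i) * (c * z) ^ (k - i)) = (\<lambda>k. (\<Sum>i\<le>k. b i * c ^ (k - i)) * z ^ k)"
    by (auto simp: fun_eq_iff sum_distrib_right power_mult_distrib simp flip: power_add intro!: sum.cong)
  finally show ?thesis by simp
qed

section \<open>Local Dirichlet integrals and partial sums of the coefficients\<close>

definition dirichlet_partial_sum :: "nat \<Rightarrow> (nat \<Rightarrow> complex) \<Rightarrow> complex \<Rightarrow> nat \<Rightarrow> complex" where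
  "dirichlet_partial_sum m a \<zeta> k = (\<Sum>j\<le>k. \<zeta> ^ j * (fact (j + m) / fact j * a (j + m)))"

text \<open>The beta value for the exponents \<open>k\<close> and \<open>m\<close> divided by
  \<open>fact m\<close>; that factorial cancels against the normalization of the Dirichlet
  integral.\<close>

definition dirichlet_weight :: "nat \<Rightarrow> nat \<Rightarrow> real" where
  "dirichlet_weight m k = fact k / fact (k + m + 1)"

lemma dirichlet_weight_nonneg: "dirichlet_weight m k \<ge> 0"
  by (simp add: dirichlet_weight_def)

text \<open>For unimodular \<zeta> the numbers \<open>z - \<zeta>\<close> and
  \<open>1 - cnj \<zeta> * z\<close> have equal modulus. Hence the denominator of the Poisson kernel
  turns the derivative into the quotient \<open>?h\<close>, while its numerator raises the exponent
  of the weight from \<open>m - 1\<close> to \<open>m\<close>. The coefficients of \<open>?h\<close>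
  are the partial sums up to the factor \<open>cnj \<zeta> ^ k\<close>.\<close>

lemma nn_integral_local_dirichlet:
  fixes a :: "nat \<Rightarrow> complex"
  assumes f: "\<And>z. cmod z < 1 \<Longrightarrow> (\<lambda>k. a k * z ^ k) sums f z" and c: "cmod \<zeta> = 1" and m: "m \<ge> 1"
  shows "(\<integral>\<^sup>+z\<in>ball 0 1. ennreal ((cmod ((deriv ^^ m) f z))\<^sup>2) * ennreal ((1 - (cmod z)\<^sup>2) / (cmod (z - \<zeta>))\<^sup>2) *
        ennreal ((1 - (cmod z)\<^sup>2) ^ (m - 1)) \<partial>disc_area) =
    ennreal (fact m) * (\<Sum>k. ennreal (dirichlet_weight m k * (cmod (dirichlet_partial_sum m a \<zeta> k))\<^sup>2))"
proof -
  let ?b = "\<lambda>k. fact (k + m) / fact k * a (k + m)"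
  let ?h = "\<lambda>z. (deriv ^^ m) f z / (1 - cnj \<zeta> * z)"
  let ?S = "dirichlet_partial_sum m a \<zeta>"
  have unit: "cnj \<zeta> * \<zeta> = 1"
    by (metis c complex_norm_square mult.commute of_real_1 power_one)
  have norm_eq: "cmod (1 - cnj \<zeta> * z) = cmod (z - \<zeta>)" for z
  proof -
    have "1 - cnj \<zeta> * z = cnj \<zeta> * (\<zeta> - z)" by (simp add: right_diff_distrib unit mult.assoc[symmetric])
    then show ?thesis using c by (simp add: norm_mult norm_minus_commute)
  qed
  have coeff: "cmod (\<Sum>i\<le>k. ?b i * cnj \<zeta> ^ (k - i)) = cmod (?S k)" for k
  proof -
    have "(\<Sum>i\<le>k. ?b i * cnj \<zeta> ^ (k - i)) = cnj \<zeta> ^ k * ?S k"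
      unfolding dirichlet_partial_sum_def sum_distrib_left
    proof (intro sum.cong refl)
      fix i assume "i \<in> {..k}"
      then have "cnj \<zeta> ^ k * \<zeta> ^ i = cnj \<zeta> ^ (k - i) * (cnj \<zeta> * \<zeta>) ^ i"
        by (simp add: power_mult_distrib mult.assoc[symmetric] flip: power_add)
      then show "?b i * cnj \<zeta> ^ (k - i) = cnj \<zeta> ^ k * (\<zeta> ^ i * ?b i)"
        by (simp add: unit mult.assoc[symmetric]) 
    qed
    then show ?thesis using c by (simp add: norm_mult norm_power)
  qed
  have "(\<integral>\<^sup>+z\<in>ball 0 1. ennreal ((cmod ((deriv ^^ m) f z))\<^sup>2) * ennreal ((1 - (cmod z)\<^sup>2) / (cmod (z - \<zeta>))\<^sup>2) *
        ennreal ((1 - (cmod z)\<^sup>2) ^ (m - 1)) \<partial>disc_area) =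
      (\<integral>\<^sup>+z\<in>ball 0 1. ennreal ((cmod (?h z))\<^sup>2 * (1 - (cmod z)\<^sup>2) ^ m) \<partial>disc_area)"
  proof (intro nn_integral_cong)
    fix z :: complex
    have "ennreal ((cmod ((deriv ^^ m) f z))\<^sup>2) * ennreal ((1 - (cmod z)\<^sup>2) / (cmod (z - \<zeta>))\<^sup>2) *
        ennreal ((1 - (cmod z)\<^sup>2) ^ (m - 1)) = ennreal ((cmod (?h z))\<^sup>2 * (1 - (cmod z)\<^sup>2) ^ m)"
      if "cmod z < 1"
    proof -
      have "(1 - (cmod z)\<^sup>2) \<ge> 0" using that by (simp add: abs_square_le_1)
      moreover have "(1 - (cmod z)\<^sup>2) ^ m = (1 - (cmod z)\<^sup>2) * (1 - (cmod z)\<^sup>2) ^ (m - 1)"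
        using m by (simp flip: power_Suc)
      ultimately show ?thesis
        by (simp add: norm_divide norm_eq power_divide flip: ennreal_mult)
    qed
    then show "ennreal ((cmod ((deriv ^^ m) f z))\<^sup>2) * ennreal ((1 - (cmod z)\<^sup>2) / (cmod (z - \<zeta>))\<^sup>2) *
        ennreal ((1 - (cmod z)\<^sup>2) ^ (m - 1)) * indicator (ball 0 1) z = ennreal ((cmod (?h z))\<^sup>2 * (1 - (cmod z)\<^sup>2) ^ m) * indicator (ball 0 1) z"
      by (cases "cmod z < 1") auto
  qed
  also have "\<dots> = (\<Sum>k. ennreal ((cmod (\<Sum>i\<le>k. ?b i * cnj \<zeta> ^ (k - i)))\<^sup>2 * (fact k * fact m / fact (k + m + 1))))"
    using power_series_higher_deriv[OF f] c
    by (intro nn_integral_power_series_disc power_series_divide_linear) auto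
  also have "\<dots> = (\<Sum>k. ennreal (fact m) * ennreal (dirichlet_weight m k * (cmod (?S k))\<^sup>2))"
    unfolding coeff dirichlet_weight_def
    by (intro suminf_cong) (simp add: mult_ac flip: ennreal_mult')
  finally show ?thesis by simp
qed

lemma borel_measurable_dirichlet_partial_sum [measurable]:
  assumes "\<mu> \<in> circle_measures"
  shows "(\<lambda>\<zeta>. dirichlet_partial_sum m a \<zeta> k) \<in> borel_measurable \<mu>"
proof -
  have s: "sets \<mu> = sets (restrict_space borel (sphere 0 1))"
    using assms by (simp add: circle_measures_def)
  have [measurable]: "(\<lambda>\<zeta>. \<zeta>) \<in> borel_measurable \<mu>"
    by (subst measurable_cong_sets[OF s refl]) (rule measurable_restrict_space1, simp)
  show ?thesis unfolding dirichlet_partial_sum_def by measurable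
qed

text \<open>Tonelli exchanges the area integral with the integral over \<mu> in the Poisson
  integral, which leaves the local integrals at the points of the circle.\<close>

lemma dirichlet_integral_power_series:
  fixes a :: "nat \<Rightarrow> complex"
  assumes f: "\<And>z. cmod z < 1 \<Longrightarrow> (\<lambda>k. a k * z ^ k) sums f z" and \<mu>: "\<mu> \<in> circle_measures" and m: "m \<ge> 1"
  shows "dirichlet_integral \<mu> m f = ennreal (1 / fact (m - 1)) *
    (\<Sum>k. ennreal (dirichlet_weight m k) * (\<integral>\<^sup>+\<zeta>. ennreal ((cmod (dirichlet_partial_sum m a \<zeta> k))\<^sup>2) \<partial>\<mu>))"
proof -
  interpret M: finite_measure \<mu> using \<mu> by (simp add: circle_measures_def)
  interpret D: finite_measure disc_area by (rule finite_measure_disc_area)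
  interpret P: pair_sigma_finite disc_area \<mu>
    by (intro pair_sigma_finite.intro D.sigma_finite_measure_axioms M.sigma_finite_measure_axioms)
  have [simp, measurable_cong]: "sets disc_area = sets borel"
    by (simp add: disc_area_def)
  have [measurable_cong]: "sets \<mu> = sets (restrict_space borel (sphere 0 1))"
    using \<mu> by (simp add: circle_measures_def)
  have space: "space \<mu> = sphere 0 1"
    using sets_eq_imp_space_eq[OF \<open>sets \<mu> = _\<close>] by (simp add: space_restrict_space)
  have id[measurable]: "(\<lambda>\<zeta>. \<zeta>) \<in> borel_measurable \<mu>"
    by (subst measurable_cong_sets[OF \<open>sets \<mu> = _\<close> refl]) (rule measurable_restrict_space1, simp)
  note [measurable] = borel_measurable_dirichlet_partial_sum[OF \<mu>]
  \<comment> \<open>The derivative is arbitrary off the disc; cutting it off gives the joint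
    measurability that Tonelli needs.\<close>
  define g where "g = (\<lambda>z. indicator (ball 0 1) z *\<^sub>R (deriv ^^ m) f z)"
  have "(deriv ^^ m) f holomorphic_on ball 0 1"
    using power_series_higher_deriv[OF f] by (rule power_series_disc_holomorphic)
  then have [measurable]: "g \<in> borel_measurable borel"
    unfolding g_def
    by (intro borel_measurable_continuous_on_indicator holomorphic_on_imp_continuous_on) auto
  have [measurable]: "ball 0 1 \<in> sets (borel :: complex measure)" by simp
  let ?F = "\<lambda>z \<zeta>. ennreal ((cmod (g z))\<^sup>2) * ennreal ((1 - (cmod z)\<^sup>2) / (cmod (z - \<zeta>))\<^sup>2) *
        ennreal ((1 - (cmod z)\<^sup>2) ^ (m - 1)) * indicator (ball 0 1) z"
  have "(\<integral>\<^sup>+ z \<in> ball 0 1. ennreal ((cmod ((deriv ^^ m) f z))\<^sup>2) * poisson_integral \<mu> z *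
        ennreal ((1 - (cmod z)\<^sup>2) ^ (m - 1)) \<partial>disc_area) = (\<integral>\<^sup>+ z. \<integral>\<^sup>+ \<zeta>. ?F z \<zeta> \<partial>\<mu> \<partial>disc_area)"
    unfolding poisson_integral_def g_def
    by (intro nn_integral_cong) (simp add: nn_integral_cmult nn_integral_multc indicator_def)
  also have "\<dots> = (\<integral>\<^sup>+ \<zeta>. \<integral>\<^sup>+ z. ?F z \<zeta> \<partial>disc_area \<partial>\<mu>)"
    by (intro P.Fubini'[symmetric]) measurable
  also have "\<dots> = (\<integral>\<^sup>+ \<zeta>. ennreal (fact m) * (\<Sum>k. ennreal (dirichlet_weight m k * (cmod (dirichlet_partial_sum m a \<zeta> k))\<^sup>2)) \<partial>\<mu>)"
  proof (intro nn_integral_cong)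
    fix \<zeta> assume "\<zeta> \<in> space \<mu>"
    then have z: "cmod \<zeta> = 1" by (simp add: space)
    have "(\<integral>\<^sup>+ z. ?F z \<zeta> \<partial>disc_area) =
        (\<integral>\<^sup>+z\<in>ball 0 1. ennreal ((cmod ((deriv ^^ m) f z))\<^sup>2) *
          ennreal ((1 - (cmod z)\<^sup>2) / (cmod (z - \<zeta>))\<^sup>2) *
          ennreal ((1 - (cmod z)\<^sup>2) ^ (m - 1)) \<partial>disc_area)"
      unfolding g_def by (intro nn_integral_cong) (simp add: indicator_def)
    also have "\<dots> = ennreal (fact m) *
        (\<Sum>k. ennreal (dirichlet_weight m k * (cmod (dirichlet_partial_sum m a \<zeta> k))\<^sup>2))"
      by (rule nn_integral_local_dirichlet[OF f z m])
    finally show "(\<integral>\<^sup>+ z. ?F z \<zeta> \<partial>disc_area) = ennreal (fact m) *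
        (\<Sum>k. ennreal (dirichlet_weight m k * (cmod (dirichlet_partial_sum m a \<zeta> k))\<^sup>2))" .
  qed
  also have "\<dots> = ennreal (fact m) * (\<Sum>k. ennreal (dirichlet_weight m k) * (\<integral>\<^sup>+\<zeta>. ennreal ((cmod (dirichlet_partial_sum m a \<zeta> k))\<^sup>2) \<partial>\<mu>))"
    by (simp add: dirichlet_weight_nonneg ennreal_mult' nn_integral_cmult nn_integral_suminf)
  finally show ?thesis
    unfolding dirichlet_integral_def
    by (simp add: mult.assoc[symmetric] flip: ennreal_mult')
qed

subsection \<open>Cesaro multipliers\<close>

lemma cesaro_binomial_0: "\<alpha> > 0 \<Longrightarrow> cesaro_binomial 0 \<alpha> = 1"
  using Gamma_real_pos[of "\<alpha> + 1"] by (simp add: cesaro_binomial_def less_imp_neq[symmetric])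

lemma cesaro_binomial_pos: "\<alpha> > 0 \<Longrightarrow> cesaro_binomial j \<alpha> > 0"
  unfolding cesaro_binomial_def by (intro divide_pos_pos mult_pos_pos Gamma_real_pos) auto

lemma cesaro_binomial_Suc:
  assumes "\<alpha> > 0"
  shows "cesaro_binomial (Suc j) \<alpha> = cesaro_binomial j \<alpha> * (real j + 1 + \<alpha>) / (real j + 1)"
proof -
  have "Gamma ((real j + \<alpha> + 1) + 1) = (real j + \<alpha> + 1) * Gamma (real j + \<alpha> + 1)"
    using assms by (intro Gamma_plus1) (auto elim!: nonpos_Ints_cases)
  moreover have "Gamma ((real j + 1) + 1) = (real j + 1) * Gamma (real j + 1)"
    by (intro Gamma_plus1) (auto elim!: nonpos_Ints_cases)
  ultimately show ?thesis
    by (simp add: cesaro_binomial_def add_ac mult_ac)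
qed

lemma cesaro_binomial_mono: "\<alpha> > 0 \<Longrightarrow> i \<le> j \<Longrightarrow> cesaro_binomial i \<alpha> \<le> cesaro_binomial j \<alpha>"
proof (rule lift_Suc_mono_le[of "\<lambda>j. cesaro_binomial j \<alpha>"])
  fix j assume "\<alpha> > 0"
  then show "cesaro_binomial j \<alpha> \<le> cesaro_binomial (Suc j) \<alpha>"
    using cesaro_binomial_pos[of \<alpha> j] by (simp add: cesaro_binomial_Suc field_simps)
qed

text \<open>The increments grow like \<open>l powr (\<alpha> - 1)\<close>, so their squares sum to
  order \<open>n powr (2 * \<alpha> - 1)\<close> exactly because \<alpha> exceeds 1/2. The constant
  serves the induction: \<open>C \<ge> 1\<close> gives the base case and
  \<open>C * (2 * \<alpha> - 1) \<ge> 2 * \<alpha>\<^sup>2\<close> the step. The leading 1 stands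
  for the final jump of the multiplier to 0.\<close>

lemma sum_cesaro_binomial_increments_sq:
  assumes \<alpha>: "\<alpha> > 1 / 2"
  defines "C \<equiv> 1 + 2 * \<alpha>\<^sup>2 / (2 * \<alpha> - 1)"
  shows "1 + (\<Sum>l<n. (cesaro_binomial (Suc l) \<alpha> - cesaro_binomial l \<alpha>)\<^sup>2) \<le>
    C * (cesaro_binomial n \<alpha>)\<^sup>2 / (real n + 1)"
proof (induction n)
  case 0
  then show ?case using \<alpha> by (simp add: cesaro_binomial_0 C_def)
next
  case (Suc n)
  define x where "x = cesaro_binomial n \<alpha>"
  define p where "p = real n + 1"
  have p: "p \<ge> 1" by (simp add: p_def)
  have C: "C * (2 * \<alpha> - 1) \<ge> 2 * \<alpha>\<^sup>2" "C \<ge> 1"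
  proof -
    have "C * (2 * \<alpha> - 1) = (2 * \<alpha> - 1) + 2 * \<alpha>\<^sup>2"
      using \<alpha> by (simp add: C_def distrib_right)
    then show "C * (2 * \<alpha> - 1) \<ge> 2 * \<alpha>\<^sup>2" using \<alpha> by simp
    show "C \<ge> 1" using \<alpha> by (simp add: C_def)
  qed
  have suc: "cesaro_binomial (Suc n) \<alpha> = x * (p + \<alpha>) / p"
    using \<alpha> by (simp add: cesaro_binomial_Suc x_def p_def)
  have "x * (p + \<alpha>) / p - x = x * \<alpha> / p"
    using p by (simp add: field_simps)
  then have inc: "(cesaro_binomial (Suc n) \<alpha> - x)\<^sup>2 = x\<^sup>2 * \<alpha>\<^sup>2 / p\<^sup>2"
    unfolding suc by (simp add: power_divide power_mult_distrib)
  \<comment> \<open>With the denominators \<open>p\<^sup>2 * (p + 1)\<close> cleared, the induction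
    step is \<open>key\<close>; here \<open>p \<ge> 1\<close> absorbs \<open>p + 1\<close> into
    \<open>2 * p\<close>.\<close>
  have "\<alpha>\<^sup>2 * (p + 1) \<le> (2 * \<alpha>\<^sup>2) * p"
    using p mult_left_mono[of 1 p "\<alpha>\<^sup>2"] by (simp add: algebra_simps)
  also have "\<dots> \<le> C * (2 * \<alpha> - 1) * p"
    using C p by (intro mult_right_mono) auto
  finally have "C * p * (p + 1) + \<alpha>\<^sup>2 * (p + 1) \<le> C * (p\<^sup>2 + 2 * \<alpha> * p)"
    by (simp add: algebra_simps power2_eq_square)
  also have "\<dots> \<le> C * (p + \<alpha>)\<^sup>2"
    using C by (intro mult_left_mono) (auto simp: power2_sum)
  finally have key: "C * p * (p + 1) + \<alpha>\<^sup>2 * (p + 1) \<le> C * (p + \<alpha>)\<^sup>2" .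
  have "C * x\<^sup>2 / p + x\<^sup>2 * \<alpha>\<^sup>2 / p\<^sup>2 = x\<^sup>2 * (C * p * (p + 1) + \<alpha>\<^sup>2 * (p + 1)) / (p\<^sup>2 * (p + 1))"
    using p by (simp add: divide_simps) (simp add: algebra_simps power2_eq_square)
  also have "\<dots> \<le> x\<^sup>2 * (C * (p + \<alpha>)\<^sup>2) / (p\<^sup>2 * (p + 1))"
    using p by (intro divide_right_mono mult_left_mono key) auto
  also have "\<dots> = C * (cesaro_binomial (Suc n) \<alpha>)\<^sup>2 / (real (Suc n) + 1)"
    unfolding suc by (simp add: power_divide power_mult_distrib p_def mult_ac add_ac)
  finally show ?case
    using Suc.IH inc by (simp add: x_def p_def)
qed

text \<open>The factor that a Cesaro mean puts on the \<open>k\<close>-th Taylor coefficient,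
  extended by 0 so that it acts on the whole series. The case distinction also guards against the
  truncated \<open>n - k\<close>.\<close>

definition cesaro_multiplier :: "real \<Rightarrow> nat \<Rightarrow> nat \<Rightarrow> real" where
  "cesaro_multiplier \<alpha> n k = (if k \<le> n then cesaro_binomial (n - k) \<alpha> / cesaro_binomial n \<alpha> else 0)"

lemma cesaro_multiplier_bounds:
  assumes "\<alpha> > 0"
  shows "0 \<le> cesaro_multiplier \<alpha> n k" "cesaro_multiplier \<alpha> n k \<le> 1"
  using cesaro_binomial_pos[OF assms] cesaro_binomial_mono[OF assms, of "n - k" n]
  by (auto simp: cesaro_multiplier_def less_imp_le)

lemma sum_cesaro_multiplier_diff_sq:
  assumes \<alpha>: "\<alpha> > 1 / 2"
  defines "C \<equiv> 1 + 2 * \<alpha>\<^sup>2 / (2 * \<alpha> - 1)"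
  shows "(\<Sum>j<N. (cesaro_multiplier \<alpha> n j - cesaro_multiplier \<alpha> n (Suc j))\<^sup>2) \<le> C / (real n + 1)"
proof -
  let ?A = "\<lambda>n. cesaro_binomial n \<alpha>"
  let ?d = "\<lambda>j. cesaro_multiplier \<alpha> n j - cesaro_multiplier \<alpha> n (Suc j)"
  have A: "?A n > 0" using \<alpha> by (intro cesaro_binomial_pos) auto
  have "(\<Sum>j<N. (?d j)\<^sup>2) = (\<Sum>j\<in>{..<N} \<inter> {..n}. (?d j)\<^sup>2)"
    by (intro sum.mono_neutral_right) (auto simp: cesaro_multiplier_def)
  also have "\<dots> \<le> (\<Sum>j\<le>n. (?d j)\<^sup>2)"
    by (intro sum_mono2) auto
  also have "\<dots> = (?d n)\<^sup>2 + (\<Sum>j<n. (?d j)\<^sup>2)"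
    by (simp add: lessThan_Suc_atMost[symmetric])
  \<comment> \<open>At \<open>j = n\<close> the multiplier drops from \<open>1 / ?A n\<close> to 0.
    The differences before it are increments of the binomials in reverse order, and those after it
    vanish.\<close>
  also have "(?d n)\<^sup>2 = 1 / (?A n)\<^sup>2"
    using \<alpha> by (simp add: cesaro_multiplier_def cesaro_binomial_0 power_divide)
  also have "(\<Sum>j<n. (?d j)\<^sup>2) = (\<Sum>j<n. (?A (Suc (n - Suc j)) - ?A (n - Suc j))\<^sup>2 / (?A n)\<^sup>2)"
    by (intro sum.cong refl)
      (auto simp: cesaro_multiplier_def power_divide Suc_diff_Suc simp flip: diff_divide_distrib)
  also have "\<dots> = (\<Sum>l<n. (?A (Suc l) - ?A l)\<^sup>2 / (?A n)\<^sup>2)"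
    by (rule sum.nat_diff_reindex)
  also have "1 / (?A n)\<^sup>2 + \<dots> = (1 + (\<Sum>l<n. (?A (Suc l) - ?A l)\<^sup>2)) / (?A n)\<^sup>2"
    by (simp add: add_divide_distrib sum_divide_distrib)
  also have "\<dots> \<le> (C * (?A n)\<^sup>2 / (real n + 1)) / (?A n)\<^sup>2"
    using sum_cesaro_binomial_increments_sq[OF \<alpha>] unfolding C_def
    by (intro divide_right_mono) auto
  also have "\<dots> = C / (real n + 1)"
    using A by simp
  finally show ?thesis .
qed

text \<open>The ratio of binomials \<open>k\<close> steps apart is a product of \<open>k\<close>
  consecutive ratios, each tending to 1.\<close>

lemma cesaro_multiplier_tendsto_1:
  assumes \<alpha>: "\<alpha> > 0"
  shows "(\<lambda>n. cesaro_multiplier \<alpha> n k) \<longlonglongrightarrow> 1"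
proof -
  let ?A = "\<lambda>n. cesaro_binomial n \<alpha>"
  have step: "(\<lambda>n. ?A n / ?A (Suc n)) \<longlonglongrightarrow> 1"
  proof -
    have "?A n / ?A (Suc n) = (real n + 1) / (real n + 1 + \<alpha>)" for n
      using cesaro_binomial_pos[OF \<alpha>, of n] \<alpha> by (simp add: cesaro_binomial_Suc)
    moreover have "(\<lambda>n. (real n + 1) / (real n + 1 + \<alpha>)) \<longlonglongrightarrow> 1"
      by real_asymp
    ultimately show ?thesis by simp
  qed
  have "(\<lambda>n. ?A n / ?A (n + k)) \<longlonglongrightarrow> 1"
  proof (induction k)
    case 0
    have "?A n / ?A n = 1" for n using cesaro_binomial_pos[OF \<alpha>, of n] by simp
    then show ?case by simp
  next
    case (Suc k)
    have "(\<lambda>n. (?A n / ?A (n + k)) * (?A (n + k) / ?A (Suc (n + k)))) \<longlonglongrightarrow> 1 * 1"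
      by (intro tendsto_mult Suc.IH LIMSEQ_ignore_initial_segment[OF step])
    moreover have "(?A n / ?A (n + k)) * (?A (n + k) / ?A (Suc (n + k))) = ?A n / ?A (n + Suc k)" for n
      using cesaro_binomial_pos[OF \<alpha>, of "n + k"] by simp
    ultimately show ?case by (simp only: mult_1)
  qed
  then have "(\<lambda>n. cesaro_multiplier \<alpha> (n + k) k) \<longlonglongrightarrow> 1"
    by (simp add: cesaro_multiplier_def)
  then show ?thesis by (rule LIMSEQ_offset)
qed



section \<open>Weighted square sums of partial sums under a multiplier\<close>

lemma dirichlet_weight_antimono: "dirichlet_weight m (Suc k) \<le> dirichlet_weight m k"
proof -
  have "dirichlet_weight m (Suc k) = dirichlet_weight m k * (real (Suc k) / real (Suc k + m + 1))"
    by (simp add: dirichlet_weight_def mult_ac)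
  also have "\<dots> \<le> dirichlet_weight m k * 1"
    using dirichlet_weight_nonneg by (intro mult_left_mono) auto
  finally show ?thesis by simp
qed

lemma dirichlet_weight_tail:
  assumes m: "m \<ge> 1"
  shows "(\<Sum>k\<in>{j<..<N}. dirichlet_weight m k) \<le> dirichlet_weight m j * (real (j + m + 1) / real m)"
proof (cases "j \<le> N")
  case True
  \<comment> \<open>The weights telescope: \<open>m\<close> times the \<open>k\<close>-th weight is
    the decrement of \<open>v\<close> at \<open>k\<close>.\<close>
  define v :: "nat \<Rightarrow> real" where "v = (\<lambda>k. fact k / fact (k + m))"
  have v: "v k - v (Suc k) = real m * dirichlet_weight m k" for k
    by (simp add: v_def dirichlet_weight_def divide_simps) (simp add: algebra_simps)
  have "real m * (\<Sum>k\<in>{j..<N}. dirichlet_weight m k) = (\<Sum>k\<in>{j..<N}. v k - v (Suc k))"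
    unfolding v by (simp add: sum_distrib_left)
  also have "\<dots> = v j - v N"
    using True by (rule sum_Suc_diff'[of j N "\<lambda>k. - v k", simplified])
  also have "\<dots> \<le> v j"
    by (simp add: v_def)
  also have "v j = dirichlet_weight m j * real (j + m + 1)"
    by (simp add: v_def dirichlet_weight_def divide_simps)
  finally have "(\<Sum>k\<in>{j..<N}. dirichlet_weight m k) \<le> dirichlet_weight m j * (real (j + m + 1) / real m)"
    using m by (simp add: field_simps)
  moreover have "(\<Sum>k\<in>{j<..<N}. dirichlet_weight m k) \<le> (\<Sum>k\<in>{j..<N}. dirichlet_weight m k)"
    using dirichlet_weight_nonneg by (intro sum_mono2) auto
  ultimately show ?thesis by linarith
next
  case False
  then show ?thesis using dirichlet_weight_nonneg[of m j] by simp
qed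

lemma summation_by_parts:
  fixes e :: "nat \<Rightarrow> real" and x :: "nat \<Rightarrow> complex"
  shows "(\<Sum>j\<le>k. of_real (e j) * x j) =
    of_real (e k) * (\<Sum>j\<le>k. x j) + (\<Sum>j<k. of_real (e j - e (Suc j)) * (\<Sum>i\<le>j. x i))"
  by (induction k) (simp_all add: algebra_simps)

text \<open>Summation by parts leaves a diagonal term and a remainder \<open>T\<close>.
  Cauchy-Schwarz bounds \<open>T\<close> by \<open>Q\<close> times a sum of earlier squares, and
  exchanging the sums turns their total weight into a tail of the weights. The predicate
  \<open>P\<close> confines the factor \<open>(k + m + 1) / m\<close>, which grows with
  \<open>k\<close>, to the indices where the multiplier may change; there a small \<open>Q\<close>
  can compensate for it.\<close>

lemma weighted_partial_sums_multiplier_bound: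
  fixes e :: "nat \<Rightarrow> real" and x :: "nat \<Rightarrow> complex"
  assumes m: "m \<ge> 1"
    and Q: "\<And>k. (\<Sum>j<k. (e j - e (Suc j))\<^sup>2) \<le> Q"
    and J: "\<And>j. \<not> P j \<Longrightarrow> e j = e (Suc j)"
  shows "(\<Sum>k<N. dirichlet_weight m k * (cmod (\<Sum>j\<le>k. of_real (e j) * x j))\<^sup>2) \<le>
    (\<Sum>k<N. dirichlet_weight m k * (cmod (\<Sum>j\<le>k. x j))\<^sup>2 *
      (2 * (e k)\<^sup>2 + (if P k then 2 * Q * (real (k + m + 1) / real m) else 0)))"
proof -
  let ?w = "dirichlet_weight m"
  define S where "S = (\<lambda>k. \<Sum>j\<le>k. x j)"
  define T where "T = (\<lambda>k. \<Sum>j<k. of_real (e j - e (Suc j)) * S j)"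
  \<comment> \<open>Dropping the indices outside \<open>P\<close> loses nothing in \<open>T\<close>,
    since their coefficients vanish.\<close>
  define y where "y = (\<lambda>j. if P j then (cmod (S j))\<^sup>2 else 0)"
  have abel: "(\<Sum>j\<le>k. of_real (e j) * x j) = of_real (e k) * S k + T k" for k
    unfolding S_def T_def by (rule summation_by_parts)
  have "0 \<le> Q" using Q[of 0] by simp
  have y: "y j \<ge> 0" for j by (simp add: y_def)
  have T: "(cmod (T k))\<^sup>2 \<le> Q * (\<Sum>j<k. y j)" for k
  proof -
    have "cmod (T k) \<le> (\<Sum>j<k. \<bar>e j - e (Suc j)\<bar> * sqrt (y j))"
      unfolding T_def using J by (intro sum_norm_le) (auto simp: norm_mult y_def simp flip: of_real_diff)
    then have "(cmod (T k))\<^sup>2 \<le> (\<Sum>j<k. \<bar>e j - e (Suc j)\<bar> * sqrt (y j))\<^sup>2"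
      by (intro power_mono) auto
    also have "\<dots> \<le> (\<Sum>j<k. \<bar>e j - e (Suc j)\<bar>\<^sup>2) * (\<Sum>j<k. (sqrt (y j))\<^sup>2)"
      by (rule Cauchy_Schwarz_ineq_sum)
    also have "\<dots> = (\<Sum>j<k. (e j - e (Suc j))\<^sup>2) * (\<Sum>j<k. y j)"
      using y by simp
    also have "\<dots> \<le> Q * (\<Sum>j<k. y j)"
      using y by (intro mult_right_mono Q sum_nonneg) auto
    finally show ?thesis .
  qed
  \<comment> \<open>The triangular sum is written over a square with a condition, so that the order
    of summation can be exchanged.\<close>
  have "(\<Sum>k<N. ?w k * (\<Sum>j<k. y j)) = (\<Sum>k<N. \<Sum>j<N. if j < k then ?w k * y j else 0)"
  proof (intro sum.cong refl)
    fix k assume "k \<in> {..<N}"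
    then have "{..<N} \<inter> {j. j < k} = {..<k}" by auto
    then show "?w k * (\<Sum>j<k. y j) = (\<Sum>j<N. if j < k then ?w k * y j else 0)"
      by (simp add: sum.If_cases sum_distrib_left)
  qed
  also have "\<dots> = (\<Sum>j<N. \<Sum>k<N. if j < k then ?w k * y j else 0)"
    by (rule sum.swap)
  also have "\<dots> = (\<Sum>j<N. y j * (\<Sum>k\<in>{j<..<N}. ?w k))"
  proof (intro sum.cong refl)
    fix j
    have "{..<N} \<inter> {k. j < k} = {j<..<N}" by auto
    then show "(\<Sum>k<N. if j < k then ?w k * y j else 0) = y j * (\<Sum>k\<in>{j<..<N}. ?w k)"
      by (simp add: sum.If_cases sum_distrib_left mult.commute)
  qed
  also have "\<dots> \<le> (\<Sum>j<N. y j * (?w j * (real (j + m + 1) / real m)))"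
    by (intro sum_mono mult_left_mono dirichlet_weight_tail m y)
  finally have swap: "(\<Sum>k<N. ?w k * (\<Sum>j<k. y j)) \<le> (\<Sum>j<N. y j * (?w j * (real (j + m + 1) / real m)))" .
  have "(\<Sum>k<N. ?w k * (cmod (\<Sum>j\<le>k. of_real (e j) * x j))\<^sup>2) \<le>
      (\<Sum>k<N. 2 * (?w k * (cmod (S k))\<^sup>2 * (e k)\<^sup>2) + 2 * Q * (?w k * (\<Sum>j<k. y j)))"
  proof (intro sum_mono)
    fix k
    have "(cmod (of_real (e k) * S k + T k))\<^sup>2 \<le> (cmod (of_real (e k) * S k) + cmod (T k))\<^sup>2"
      by (intro power_mono norm_triangle_ineq) auto
    also have "\<dots> \<le> 2 * (cmod (of_real (e k) * S k))\<^sup>2 + 2 * (cmod (T k))\<^sup>2"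
      using zero_le_power2[of "cmod (of_real (e k) * S k) - cmod (T k)"]
      unfolding power2_sum power2_diff by linarith
    also have "\<dots> \<le> 2 * ((e k)\<^sup>2 * (cmod (S k))\<^sup>2) + 2 * (Q * (\<Sum>j<k. y j))"
      using T[of k] by (simp add: norm_mult power_mult_distrib)
    finally have "?w k * (cmod (of_real (e k) * S k + T k))\<^sup>2 \<le>
        ?w k * (2 * ((e k)\<^sup>2 * (cmod (S k))\<^sup>2) + 2 * (Q * (\<Sum>j<k. y j)))"
      using dirichlet_weight_nonneg by (intro mult_left_mono) auto
    then show "?w k * (cmod (\<Sum>j\<le>k. of_real (e j) * x j))\<^sup>2 \<le>
      2 * (?w k * (cmod (S k))\<^sup>2 * (e k)\<^sup>2) + 2 * Q * (?w k * (\<Sum>j<k. y j))"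
      unfolding abel by (simp add: algebra_simps)
  qed
  also have "\<dots> = (\<Sum>k<N. 2 * (?w k * (cmod (S k))\<^sup>2 * (e k)\<^sup>2)) + 2 * Q * (\<Sum>k<N. ?w k * (\<Sum>j<k. y j))"
    by (simp add: sum.distrib sum_distrib_left)
  also have "\<dots> \<le> (\<Sum>k<N. 2 * (?w k * (cmod (S k))\<^sup>2 * (e k)\<^sup>2)) +
      2 * Q * (\<Sum>j<N. y j * (?w j * (real (j + m + 1) / real m)))"
    using \<open>0 \<le> Q\<close> by (intro add_left_mono mult_left_mono swap) auto
  also have "\<dots> = (\<Sum>k<N. ?w k * (cmod (S k))\<^sup>2 *
      (2 * (e k)\<^sup>2 + (if P k then 2 * Q * (real (k + m + 1) / real m) else 0)))"
    unfolding sum_distrib_left sum.distrib[symmetric]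
    by (intro sum.cong refl) (simp add: y_def algebra_simps)
  finally show ?thesis by (simp add: S_def)
qed

text \<open>Dominated convergence for the counting measure, with majorant
  \<open>X k * ennreal K\<close>.\<close>

lemma tannery_ennreal:
  fixes X :: "nat \<Rightarrow> ennreal" and \<epsilon> :: "nat \<Rightarrow> nat \<Rightarrow> real"
  assumes X: "(\<Sum>k. X k) < \<infinity>" and K: "\<And>n k. \<epsilon> n k \<le> K" and lim: "\<And>k. (\<lambda>n. \<epsilon> n k) \<longlonglongrightarrow> 0"
  shows "(\<lambda>n. \<Sum>k. X k * ennreal (\<epsilon> n k)) \<longlonglongrightarrow> 0"
proof -
  \<comment> \<open>Multiplication by a constant is continuous at 0 only if the constant is
    finite.\<close>
  have fin: "X k < \<infinity>" for k
    using X by (metis ennreal_suminf_lessD infinity_ennreal_def)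
  have "(\<lambda>n. \<integral>\<^sup>+k. X k * ennreal (\<epsilon> n k) \<partial>count_space UNIV) \<longlonglongrightarrow> (\<integral>\<^sup>+(k::nat). 0 \<partial>count_space UNIV)"
  proof (rule nn_integral_dominated_convergence[where w = "\<lambda>k. X k * ennreal K"])
    show "(\<integral>\<^sup>+k. X k * ennreal K \<partial>count_space UNIV) < \<infinity>"
      using X by (simp add: nn_integral_multc nn_integral_count_space_nat ennreal_mult_less_top)
    show "AE k in count_space UNIV. (\<lambda>n. X k * ennreal (\<epsilon> n k)) \<longlonglongrightarrow> 0"
    proof (intro AE_I2)
      fix k
      have "(\<lambda>n. X k * ennreal (\<epsilon> n k)) \<longlonglongrightarrow> X k * ennreal 0"
        using fin[of k] by (intro ennreal_tendsto_cmult tendsto_ennrealI lim) auto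
      then show "(\<lambda>n. X k * ennreal (\<epsilon> n k)) \<longlonglongrightarrow> 0" by simp
    qed
  qed (auto intro!: mult_left_mono ennreal_leI K)
  then show ?thesis by (simp add: nn_integral_count_space_nat)
qed

subsection \<open>Convergence in norm\<close>

lemma cesaro_mean_power_series:
  assumes f: "f holomorphic_on ball 0 1" and z: "cmod z < 1"
  defines "a \<equiv> \<lambda>k. (deriv ^^ k) f 0 / fact k"
  shows "(\<lambda>k. of_real (cesaro_multiplier \<alpha> n k - 1) * a k * z ^ k) sums (cesaro_mean n \<alpha> f z - f z)"
proof -
  \<comment> \<open>The finite sum is recast as a series with finitely many nonzero terms, so that
    the series of \<open>f\<close> can be subtracted termwise.\<close>
  have "(\<lambda>k. if k \<in> {..n} then of_real (cesaro_multiplier \<alpha> n k) * a k * z ^ k else 0) sums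
      (\<Sum>k\<in>{..n}. of_real (cesaro_multiplier \<alpha> n k) * a k * z ^ k)"
    by (rule sums_If_finite_set) simp
  also have "(\<lambda>k. if k \<in> {..n} then of_real (cesaro_multiplier \<alpha> n k) * a k * z ^ k else 0) =
      (\<lambda>k. of_real (cesaro_multiplier \<alpha> n k) * a k * z ^ k)"
    by (auto simp: fun_eq_iff cesaro_multiplier_def)
  also have "(\<Sum>k\<in>{..n}. of_real (cesaro_multiplier \<alpha> n k) * a k * z ^ k) = cesaro_mean n \<alpha> f z"
    unfolding cesaro_mean_def sum_distrib_left
    by (intro sum.cong refl) (simp add: cesaro_multiplier_def a_def fps_expansion_def field_simps)
  finally have "(\<lambda>k. of_real (cesaro_multiplier \<alpha> n k) * a k * z ^ k) sums cesaro_mean n \<alpha> f z" .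
  moreover have "(\<lambda>k. a k * z ^ k) sums f z"
    using holomorphic_power_series[OF f, of z] z by (simp add: a_def)
  ultimately have "(\<lambda>k. of_real (cesaro_multiplier \<alpha> n k) * a k * z ^ k - a k * z ^ k) sums
      (cesaro_mean n \<alpha> f z - f z)"
    by (rule sums_diff)
  then show ?thesis by (simp add: algebra_simps)
qed

text \<open>The multiplier bound is applied at each \<zeta> to finite sums, with the multiplier
  shifted by \<open>m\<close> because the partial sums start at \<open>a m\<close>. Its factors do
  not depend on \<zeta>, so they leave the integral.\<close>

lemma dirichlet_integral_cesaro_le:
  fixes a :: "nat \<Rightarrow> complex"
  assumes \<mu>: "\<mu> \<in> circle_measures" and m: "m \<ge> 1" and \<alpha>: "\<alpha> > 1 / 2"
  defines "C \<equiv> 1 + 2 * \<alpha>\<^sup>2 / (2 * \<alpha> - 1)"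
  shows "(\<Sum>k. ennreal (dirichlet_weight m k) * (\<integral>\<^sup>+\<zeta>. ennreal ((cmod
      (dirichlet_partial_sum m (\<lambda>k. of_real (cesaro_multiplier \<alpha> n k - 1) * a k) \<zeta> k))\<^sup>2) \<partial>\<mu>)) \<le>
    (\<Sum>k. ennreal (dirichlet_weight m k) * (\<integral>\<^sup>+\<zeta>. ennreal ((cmod
      (dirichlet_partial_sum m a \<zeta> k))\<^sup>2) \<partial>\<mu>) * ennreal (2 * (cesaro_multiplier \<alpha> n (k + m) - 1)\<^sup>2 +
        (if k + m \<le> n then 2 * (C / (real n + 1)) * (real (k + m + 1) / real m) else 0)))"
    (is "(\<Sum>k. ?w k * ?D' k) \<le> (\<Sum>k. ?w k * ?D k * ennreal (?\<epsilon> k))")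
proof (rule suminf_le_const)
  fix N
  note [measurable] = borel_measurable_dirichlet_partial_sum[OF \<mu>]
  let ?b = "\<lambda>k. of_real (cesaro_multiplier \<alpha> n k - 1) * a k"
  have "0 \<le> C" using \<alpha> by (simp add: C_def)
  then have eps: "?\<epsilon> k \<ge> 0" for k by simp
  have pointwise: "(\<Sum>k<N. dirichlet_weight m k * (cmod (dirichlet_partial_sum m ?b \<zeta> k))\<^sup>2) \<le>
      (\<Sum>k<N. dirichlet_weight m k * (cmod (dirichlet_partial_sum m a \<zeta> k))\<^sup>2 * ?\<epsilon> k)" for \<zeta>
  proof -
    let ?e = "\<lambda>j. cesaro_multiplier \<alpha> n (j + m) - 1"
    let ?x = "\<lambda>j. \<zeta> ^ j * (fact (j + m) / fact j * a (j + m))"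
    have "(\<Sum>j<k. (?e j - ?e (Suc j))\<^sup>2) \<le> C / (real n + 1)" for k
    proof -
      let ?d = "\<lambda>j. (cesaro_multiplier \<alpha> n j - cesaro_multiplier \<alpha> n (Suc j))\<^sup>2"
      have "(\<Sum>j<k. (?e j - ?e (Suc j))\<^sup>2) = (\<Sum>j\<in>{m..<k + m}. ?d j)"
        using sum.shift_bounds_nat_ivl[of ?d 0 m k] by (simp add: lessThan_atLeast0)
      also have "\<dots> \<le> (\<Sum>j<k + m. ?d j)"
        by (intro sum_mono2) auto
      also have "\<dots> \<le> C / (real n + 1)"
        unfolding C_def by (rule sum_cesaro_multiplier_diff_sq[OF \<alpha>])
      finally show ?thesis .
    qed
    \<comment> \<open>Beyond \<open>n\<close> both multipliers are 0. The index with
      \<open>j + m = n\<close> must stay inside \<open>P\<close>, because the jump to 0 happens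
      there.\<close>
    moreover have "?e j = ?e (Suc j)" if "\<not> j + m \<le> n" for j
      using that by (simp add: cesaro_multiplier_def)
    ultimately have "(\<Sum>k<N. dirichlet_weight m k * (cmod (\<Sum>j\<le>k. of_real (?e j) * ?x j))\<^sup>2) \<le>
        (\<Sum>k<N. dirichlet_weight m k * (cmod (\<Sum>j\<le>k. ?x j))\<^sup>2 * ?\<epsilon> k)"
      by (rule weighted_partial_sums_multiplier_bound[where P = "\<lambda>j. j + m \<le> n", OF m])
    moreover have "of_real (?e j) * ?x j = \<zeta> ^ j * (fact (j + m) / fact j * ?b (j + m))" for j
      by (simp only: mult_ac)
    ultimately show ?thesis unfolding dirichlet_partial_sum_def by (simp only:)
  qed
  have "(\<Sum>k<N. ?w k * ?D' k) =
      (\<integral>\<^sup>+\<zeta>. ennreal (\<Sum>k<N. dirichlet_weight m k * (cmod (dirichlet_partial_sum m ?b \<zeta> k))\<^sup>2) \<partial>\<mu>)"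
    by (simp add: nn_integral_sum nn_integral_cmult ennreal_mult dirichlet_weight_nonneg flip: sum_ennreal)
  also have "\<dots> \<le> (\<integral>\<^sup>+\<zeta>. ennreal (\<Sum>k<N. dirichlet_weight m k * (cmod (dirichlet_partial_sum m a \<zeta> k))\<^sup>2 * ?\<epsilon> k) \<partial>\<mu>)"
    by (intro nn_integral_mono ennreal_leI pointwise)
  also have "\<dots> = (\<integral>\<^sup>+\<zeta>. (\<Sum>k<N. ?w k * ennreal ((cmod (dirichlet_partial_sum m a \<zeta> k))\<^sup>2) * ennreal (?\<epsilon> k)) \<partial>\<mu>)"
    by (intro nn_integral_cong, subst sum_ennreal[symmetric])
      (auto intro!: sum.cong mult_nonneg_nonneg eps simp: ennreal_mult dirichlet_weight_nonneg eps simp del: ennreal_plus)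
  also have "\<dots> = (\<Sum>k<N. ?w k * ?D k * ennreal (?\<epsilon> k))"
    by (simp add: nn_integral_sum nn_integral_cmult nn_integral_multc del: ennreal_plus)
  also have "\<dots> \<le> (\<Sum>k. ?w k * ?D k * ennreal (?\<epsilon> k))"
    by (intro sum_le_suminf) auto
  finally show "(\<Sum>k<N. ?w k * ?D' k) \<le> (\<Sum>k. ?w k * ?D k * ennreal (?\<epsilon> k))" .
qed (rule summableI)

text \<open>For nonzero \<mu> membership in the space only bounds the Dirichlet integral, while the
  norm also needs the Hardy part. Consecutive partial sums differ by a Taylor coefficient times
  \<open>F\<close>, and the weight times the square of \<open>F\<close> is at least 1/2. The
  resulting bound is uniform in \<zeta>, so integrating it produces the total mass of \<mu>, which
  is nonzero and finiteness carries over to the coefficients.\<close>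

lemma square_summable_if_dirichlet_finite:
  fixes a :: "nat \<Rightarrow> complex"
  assumes \<mu>: "\<mu> \<in> circle_measures" and m: "m \<ge> 1" and nz: "emeasure \<mu> (space \<mu>) \<noteq> 0"
    and fin: "(\<Sum>k. ennreal (dirichlet_weight m k) *
      (\<integral>\<^sup>+\<zeta>. ennreal ((cmod (dirichlet_partial_sum m a \<zeta> k))\<^sup>2) \<partial>\<mu>)) < \<infinity>"
      (is "(\<Sum>k. ?w k * ?D k) < \<infinity>")
  shows "(\<Sum>k. ennreal ((cmod (a k))\<^sup>2)) < \<infinity>"
proof -
  note [measurable] = borel_measurable_dirichlet_partial_sum[OF \<mu>]
  let ?S = "dirichlet_partial_sum m a"
  let ?M = "emeasure \<mu> (space \<mu>)"
  have space: "space \<mu> = sphere 0 1"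
    using \<mu> sets_eq_imp_space_eq[of \<mu> "restrict_space borel (sphere 0 1)"]
    by (simp add: circle_measures_def space_restrict_space)
  have bound: "ennreal ((cmod (a (Suc k + m)))\<^sup>2) * ?M \<le> 4 * (?w (Suc k) * ?D (Suc k) + ?w k * ?D k)" for k
  proof -
    have pointwise: "(cmod (a (Suc k + m)))\<^sup>2 \<le>
        4 * (dirichlet_weight m (Suc k) * (cmod (?S \<zeta> (Suc k)))\<^sup>2 + dirichlet_weight m k * (cmod (?S \<zeta> k))\<^sup>2)"
      if "cmod \<zeta> = 1" for \<zeta>
    proof -
      let ?w = "dirichlet_weight m"
      define F :: real where "F = fact (Suc k + m) / fact (Suc k)"
      \<comment> \<open>Here \<open>m \<ge> 1\<close> enters: one factor is split off the factorial,
        and the remaining quotient is at least 1.\<close>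
      have F: "F \<ge> real (Suc k + m)"
      proof -
        obtain m' where m': "m = Suc m'" using m by (cases m) auto
        have "F = real (Suc k + m) * (fact (Suc k + m') / fact (Suc k))"
          unfolding F_def m' by simp
        moreover have "fact (Suc k) \<le> (fact (Suc k + m') :: real)" by (intro fact_mono) auto
        then have "1 \<le> fact (Suc k + m') / (fact (Suc k) :: real)" by simp
        ultimately show ?thesis
          using mult_left_mono[of 1 "fact (Suc k + m') / (fact (Suc k) :: real)" "real (Suc k + m)"] by simp
      qed
      then have "F > 0" by simp
      have wF: "?w (Suc k) * F = 1 / real (Suc k + m + 1)"
        by (simp add: dirichlet_weight_def F_def)
      have "1 / 2 \<le> real (Suc k + m) / real (Suc k + m + 1)" by simp
      also have "\<dots> \<le> F / real (Suc k + m + 1)" using F by (intro divide_right_mono) auto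
      also have "\<dots> = ?w (Suc k) * F\<^sup>2" using wF by (simp add: power2_eq_square mult.assoc[symmetric])
      finally have half: "1 / 2 \<le> ?w (Suc k) * F\<^sup>2" .
      have "?S \<zeta> (Suc k) - ?S \<zeta> k = \<zeta> ^ Suc k * (of_real F * a (Suc k + m))"
        by (simp add: dirichlet_partial_sum_def F_def)
      then have "F * cmod (a (Suc k + m)) = cmod (?S \<zeta> (Suc k) - ?S \<zeta> k)"
        using that \<open>F > 0\<close> by (simp only: norm_mult norm_power) simp
      also have "\<dots> \<le> cmod (?S \<zeta> (Suc k)) + cmod (?S \<zeta> k)"
        by (rule norm_triangle_ineq4)
      finally have "(F * cmod (a (Suc k + m)))\<^sup>2 \<le> (cmod (?S \<zeta> (Suc k)) + cmod (?S \<zeta> k))\<^sup>2"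
        using \<open>F > 0\<close> by (intro power_mono) auto
      also have "\<dots> \<le> 2 * (cmod (?S \<zeta> (Suc k)))\<^sup>2 + 2 * (cmod (?S \<zeta> k))\<^sup>2"
        using zero_le_power2[of "cmod (?S \<zeta> (Suc k)) - cmod (?S \<zeta> k)"]
        unfolding power2_sum power2_diff by linarith
      finally have sq: "F\<^sup>2 * (cmod (a (Suc k + m)))\<^sup>2 \<le> 2 * (cmod (?S \<zeta> (Suc k)))\<^sup>2 + 2 * (cmod (?S \<zeta> k))\<^sup>2"
        by (simp add: power_mult_distrib)
      have "1 / 2 * (cmod (a (Suc k + m)))\<^sup>2 \<le> ?w (Suc k) * F\<^sup>2 * (cmod (a (Suc k + m)))\<^sup>2"
        using half by (intro mult_right_mono) auto
      also have "\<dots> \<le> ?w (Suc k) * (2 * (cmod (?S \<zeta> (Suc k)))\<^sup>2 + 2 * (cmod (?S \<zeta> k))\<^sup>2)"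
        unfolding mult.assoc using sq dirichlet_weight_nonneg by (intro mult_left_mono) auto
      \<comment> \<open>Monotonicity of the weights gives each partial sum the weight of its own
        index, as in the Dirichlet series.\<close>
      also have "\<dots> \<le> ?w (Suc k) * (2 * (cmod (?S \<zeta> (Suc k)))\<^sup>2) + ?w k * (2 * (cmod (?S \<zeta> k))\<^sup>2)"
        unfolding distrib_left by (intro add_left_mono mult_right_mono dirichlet_weight_antimono) auto
      finally show ?thesis by (simp add: algebra_simps)
    qed
    have "ennreal ((cmod (a (Suc k + m)))\<^sup>2) * ?M = (\<integral>\<^sup>+\<zeta>. ennreal ((cmod (a (Suc k + m)))\<^sup>2) \<partial>\<mu>)"
      by simp
    also have "\<dots> \<le> (\<integral>\<^sup>+\<zeta>. 4 * (?w (Suc k) * ennreal ((cmod (?S \<zeta> (Suc k)))\<^sup>2) + ?w k * ennreal ((cmod (?S \<zeta> k))\<^sup>2)) \<partial>\<mu>)"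
    proof (intro nn_integral_mono)
      fix \<zeta> assume "\<zeta> \<in> space \<mu>"
      then have "cmod \<zeta> = 1" by (simp add: space)
      then have "ennreal ((cmod (a (Suc k + m)))\<^sup>2) \<le> ennreal (4 * (dirichlet_weight m (Suc k) * (cmod (?S \<zeta> (Suc k)))\<^sup>2 + dirichlet_weight m k * (cmod (?S \<zeta> k))\<^sup>2))"
        by (intro ennreal_leI pointwise)
      also have "\<dots> = 4 * (?w (Suc k) * ennreal ((cmod (?S \<zeta> (Suc k)))\<^sup>2) + ?w k * ennreal ((cmod (?S \<zeta> k))\<^sup>2))"
        by (simp add: ennreal_mult dirichlet_weight_nonneg)
      finally show "ennreal ((cmod (a (Suc k + m)))\<^sup>2) \<le> \<dots>" .
    qed
    also have "\<dots> = 4 * (?w (Suc k) * ?D (Suc k) + ?w k * ?D k)"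
      by (simp add: nn_integral_cmult nn_integral_add)
    finally show ?thesis .
  qed
  have tail: "(\<Sum>k. ?w (Suc k) * ?D (Suc k)) \<le> (\<Sum>k. ?w k * ?D k)"
    using suminf_offset[of "\<lambda>k. ?w k * ?D k" 1] by (simp add: add_increasing)
  have "(\<Sum>k. ennreal ((cmod (a (k + Suc m)))\<^sup>2)) * ?M = (\<Sum>k. ennreal ((cmod (a (Suc k + m)))\<^sup>2) * ?M)"
    by simp
  also have "\<dots> \<le> (\<Sum>k. 4 * (?w (Suc k) * ?D (Suc k) + ?w k * ?D k))"
    by (intro suminf_le bound) auto
  also have "\<dots> = 4 * ((\<Sum>k. ?w (Suc k) * ?D (Suc k)) + (\<Sum>k. ?w k * ?D k))"
    unfolding ennreal_suminf_cmult by (subst suminf_add) auto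
  also have "\<dots> \<le> 4 * ((\<Sum>k. ?w k * ?D k) + (\<Sum>k. ?w k * ?D k))"
    by (intro mult_left_mono add_right_mono tail) auto
  also have "\<dots> < \<infinity>"
    using fin by (simp add: ennreal_mult_less_top)
  finally have fin_tail: "(\<Sum>k. ennreal ((cmod (a (k + Suc m)))\<^sup>2)) < \<infinity>"
    using nz by (auto simp: ennreal_mult_less_top)
  have split: "(\<Sum>k. ennreal ((cmod (a k))\<^sup>2)) =
      (\<Sum>k. ennreal ((cmod (a (k + Suc m)))\<^sup>2)) + (\<Sum>k<Suc m. ennreal ((cmod (a k))\<^sup>2))"
    by (rule suminf_offset) auto
  have "(\<Sum>k<Suc m. ennreal ((cmod (a k))\<^sup>2)) < \<infinity>"
    by (simp del: sum.lessThan_Suc)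
  with fin_tail show ?thesis
    unfolding split infinity_ennreal_def by (simp only: ennreal_add_less_top)
qed

lemma dirichlet_norm_tendsto_0:
  assumes "(\<lambda>n. hardy_norm_sq (g n) + dirichlet_integral \<mu> m (g n)) \<longlonglongrightarrow> 0"
  shows "(\<lambda>n. dirichlet_norm \<mu> m (g n)) \<longlonglongrightarrow> 0"
proof -
  let ?N = "\<lambda>n. hardy_norm_sq (g n) + dirichlet_integral \<mu> m (g n)"
  have "(\<lambda>n. enn2real (?N n)) \<longlonglongrightarrow> 0"
    using tendsto_enn2real[of ?N 0] assms by simp
  then have "(\<lambda>n. ennreal (sqrt (enn2real (?N n)))) \<longlonglongrightarrow> ennreal (sqrt 0)"
    by (intro tendsto_ennrealI tendsto_real_sqrt)
  then have "(\<lambda>n. ennreal (sqrt (enn2real (?N n)))) \<longlonglongrightarrow> 0" by simp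
  moreover have "\<forall>\<^sub>F n in sequentially. dirichlet_norm \<mu> m (g n) = ennreal (sqrt (enn2real (?N n)))"
  proof -
    \<comment> \<open>Rules out, for large \<open>n\<close>, the branch in which the norm is
      infinite.\<close>
    have "\<forall>\<^sub>F n in sequentially. ?N n < 1"
      using assms by (rule order_tendstoD) simp
    then show ?thesis
      by eventually_elim (auto simp: dirichlet_norm_def Let_def)
  qed
  ultimately show ?thesis by (simp add: tendsto_cong)
qed

theorem corollary1p2:
  fixes \<mu> :: "complex measure" and m :: nat and \<alpha> :: real and f :: "complex \<Rightarrow> complex"
  assumes "\<mu> \<in> circle_measures"
    and "m \<ge> 1"
    and "\<alpha> > 1 / 2"
    and "f \<in> dirichlet_space \<mu> m"
  shows "(\<lambda>n. dirichlet_norm \<mu> m (\<lambda>z. cesaro_mean n \<alpha> f z - f z)) \<longlonglongrightarrow> 0"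
proof -
  define a where "a = (\<lambda>k. (deriv ^^ k) f 0 / fact k)"
  define c where "c = cesaro_multiplier \<alpha>"
  define C where "C = 1 + 2 * \<alpha>\<^sup>2 / (2 * \<alpha> - 1)"
  define E where "E = (\<lambda>n k. 2 * (c n (k + m) - 1)\<^sup>2 +
        (if k + m \<le> n then 2 * (C / (real n + 1)) * (real (k + m + 1) / real m) else 0))"
  define X where "X = (\<lambda>k. ennreal (dirichlet_weight m k) *
      (\<integral>\<^sup>+\<zeta>. ennreal ((cmod (dirichlet_partial_sum m a \<zeta> k))\<^sup>2) \<partial>\<mu>))"
  have \<alpha>: "\<alpha> > 0" using assms(3) by simp
  have "C \<ge> 0" using assms(3) by (simp add: C_def)
  have hol: "f holomorphic_on ball 0 1"
    using assms(4) by (auto simp: dirichlet_space_def hardy_space_def split: if_splits)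
  then have f: "(\<lambda>k. a k * z ^ k) sums f z" if "cmod z < 1" for z
    using holomorphic_power_series[OF hol, of z] that by (simp add: a_def)
  have g: "(\<lambda>k. of_real (c n k - 1) * a k * z ^ k) sums (cesaro_mean n \<alpha> f z - f z)"
    if "cmod z < 1" for z n
    using cesaro_mean_power_series[OF hol that] by (simp add: a_def c_def)
  \<comment> \<open>Both parts of the norm are finite. For zero \<mu> the first sum vanishes and the
    second is the Hardy norm; otherwise finiteness of the first implies that of the second.\<close>
  have X: "(\<Sum>k. X k) < \<infinity> \<and> (\<Sum>k. ennreal ((cmod (a k))\<^sup>2)) < \<infinity>"
  proof (cases "emeasure \<mu> (space \<mu>) = 0")
    case True
    have "X k = 0" for k
    proof -
      have "(\<integral>\<^sup>+\<zeta>. ennreal ((cmod (dirichlet_partial_sum m a \<zeta> k))\<^sup>2) \<partial>\<mu>) = (\<integral>\<^sup>+\<zeta>. 0 \<partial>\<mu>)"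
        using True by (intro nn_integral_cong_AE) (auto intro!: AE_I[where N = "space \<mu>"])
      then show ?thesis by (simp add: X_def)
    qed
    moreover have "hardy_norm_sq f < \<infinity>"
      using True assms(4) by (simp add: dirichlet_space_def hardy_space_def)
    ultimately show ?thesis by (simp add: hardy_norm_sq_power_series[OF f])
  next
    case False
    then have "dirichlet_integral \<mu> m f < \<infinity>"
      using assms(4) by (simp add: dirichlet_space_def)
    moreover have "dirichlet_integral \<mu> m f = ennreal (1 / fact (m - 1)) * (\<Sum>k. X k)"
      unfolding X_def by (rule dirichlet_integral_power_series[OF f assms(1,2)])
    ultimately have "(\<Sum>k. X k) < \<infinity>"
      by (auto simp: ennreal_mult_less_top)
    then show ?thesis
      using square_summable_if_dirichlet_finite[OF assms(1,2) False, of a] unfolding X_def by blast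
  qed
  have c_bounds: "0 \<le> c n k" "c n k \<le> 1" for n k
    using cesaro_multiplier_bounds[OF \<alpha>] by (simp_all add: c_def)
  have c_lim: "(\<lambda>n. (c n k - 1)\<^sup>2) \<longlonglongrightarrow> 0" for k
    using tendsto_power[OF tendsto_diff[OF cesaro_multiplier_tendsto_1[OF \<alpha>, of k] tendsto_const[of 1]], of 2]
    by (simp add: c_def)
  have c_sq: "(c n k - 1)\<^sup>2 \<le> 1" for n k
    using c_bounds[of n k] by (simp add: abs_square_le_1)
  have hardy: "(\<lambda>n. hardy_norm_sq (\<lambda>z. cesaro_mean n \<alpha> f z - f z)) \<longlonglongrightarrow> 0"
  proof -
    have eq: "hardy_norm_sq (\<lambda>z. cesaro_mean n \<alpha> f z - f z) =
        (\<Sum>k. ennreal ((cmod (a k))\<^sup>2) * ennreal ((c n k - 1)\<^sup>2))" for n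
      by (subst hardy_norm_sq_power_series[OF g], assumption, intro suminf_cong)
        (simp add: norm_mult power_mult_distrib mult.commute flip: ennreal_mult of_real_diff)
    show ?thesis
      unfolding eq using X by (intro tannery_ennreal[where K = 1] c_sq c_lim) (rule conjunct2)
  qed
  \<comment> \<open>The bound must be uniform in both indices: under \<open>k + m \<le> n\<close>
    the growth of \<open>k + m + 1\<close> is absorbed by \<open>n + 1\<close>.\<close>
  have "E n k \<le> 2 + 2 * C" for n k
  proof -
    have "2 * (C / (real n + 1)) * (real (k + m + 1) / real m) \<le> 2 * C" if "k + m \<le> n"
    proof -
      have "real (k + m + 1) / (real n + 1) \<le> 1" using that by simp
      moreover have "1 / real m \<le> 1" using assms(2) by simp
      ultimately have "(real (k + m + 1) / (real n + 1)) * (1 / real m) \<le> 1 * 1"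
        by (intro mult_mono) auto
      from mult_left_mono[OF this, of "2 * C"] show ?thesis using \<open>C \<ge> 0\<close> by simp
    qed
    then show ?thesis using c_sq[of n "k + m"] \<open>C \<ge> 0\<close> unfolding E_def by (auto split: if_split)
  qed
  \<comment> \<open>For fixed \<open>k\<close> the condition holds eventually, and the second term
    is then a constant multiple of \<open>1 / (n + 1)\<close>.\<close>
  moreover have "(\<lambda>n. E n k) \<longlonglongrightarrow> 0" for k
  proof -
    have "(\<lambda>n. 2 * (C / (real n + 1)) * (real (k + m + 1) / real m)) \<longlonglongrightarrow> 0"
      by real_asymp
    then have "(\<lambda>n. if k + m \<le> n then 2 * (C / (real n + 1)) * (real (k + m + 1) / real m) else 0) \<longlonglongrightarrow> 0"
      by (rule Lim_transform_eventually) (rule eventually_mono[OF eventually_ge_at_top[of "k + m"]], simp)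
    then show ?thesis
      unfolding E_def using tendsto_add[OF tendsto_mult[OF tendsto_const[of 2] c_lim[of "k + m"]]] by fastforce
  qed
  ultimately have "(\<lambda>n. \<Sum>k. X k * ennreal (E n k)) \<longlonglongrightarrow> 0"
    using X by (intro tannery_ennreal) auto
  from ennreal_tendsto_cmult[OF _ this, of "ennreal (1 / fact (m - 1))"]
  have lim: "(\<lambda>n. ennreal (1 / fact (m - 1)) * (\<Sum>k. X k * ennreal (E n k))) \<longlonglongrightarrow> 0"
    by simp
  have le: "dirichlet_integral \<mu> m (\<lambda>z. cesaro_mean n \<alpha> f z - f z) \<le>
      ennreal (1 / fact (m - 1)) * (\<Sum>k. X k * ennreal (E n k))" for n
    unfolding X_def E_def c_def C_def
    by (subst dirichlet_integral_power_series[OF g[unfolded c_def] assms(1,2)], assumption)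
      (intro mult_left_mono dirichlet_integral_cesaro_le assms, simp)
  have "(\<lambda>n. dirichlet_integral \<mu> m (\<lambda>z. cesaro_mean n \<alpha> f z - f z)) \<longlonglongrightarrow> 0"
    by (rule tendsto_sandwich[OF always_eventually always_eventually tendsto_const lim])
      (intro allI zero_le le)+
  from tendsto_add[OF hardy this] show ?thesis
    by (intro dirichlet_norm_tendsto_0) simp
qed

end
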